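(* Let $a(u,v)=\int_\Omega\kappa\,\nabla u\cdot\nabla v\,dx$, assumed continuous and coercive on $V=H_0^1(\Omega)$. Let $V_M^h\subset V_h\subset V$ be the discrete spectral subspace and let $A_{LL}\in\mathbb{R}^{K\times K}$ be the reduced stiffness matrix associated with $a$ on $V_M^h$, written in a basis $\{\psi_i\}_{i=1}^K$ of $V_M^h$ whose $H_0^1$ Gram matrix $G_{ij}=(\psi_j,\psi_i)_{H_0^1}$ is uniformly well conditioned with respect to $h$ and $M$ (that is, $\kappa_2(G)$ is bounded by a constant independent of $h$ and $M$); so $$(A_{LL})_{ij}=a(\psi_j,\psi_i).$$ Then $A_{LL}$ is symmetric positive definite and there exists a constant $C_{\mathrm{cond}}>0$, independent of $h$ and $M$, such that $$\kappa_2(A_{LL})=\frac{\lambda_{\max}(A_{LL})}{\lambda_{\min}(A_{LL})}\le C_{\mathrm{cond}}.$$ In particular, $C_{\mathrm{cond}}$ depends on the continuity and coercivity constants of $a$ and on the basis stability through $\kappa_2(G)$.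
   Context: $\Omega=(0,1)^2$; $\kappa$ is a (measurable) coefficient with $0<\kappa_{\min}\le\kappa(x)\le\kappa_{\max}<\infty$ on $\Omega$. The inner product on $H_0^1(\Omega)$ is $(u,v)_{H_0^1}=\int_\Omega\nabla u\cdot\nabla v\,dx$. $V_h\subset H_0^1(\Omega)$ is a finite-dimensional (finite element) subspace with mesh parameter $h$. With $\phi_{mn}(x,y)=\sin(m\pi x)\sin(n\pi y)$ and $V_M=\operatorname{span}\{\phi_{mn}:1\le m,n\le M\}$, the discrete spectral subspace is $V_M^h:=\Pi_hV_M\subset V_h$, where $\Pi_h$ is a fixed projection or interpolation operator onto $V_h$ (e.g. nodal interpolation, $L^2$ or energy projection) applied to each $\phi_{mn}$; $K=\dim V_M^h=M^2$. For each pair $(h,M)$ a basis $\{\psi_i\}_{i=1}^K$ of $V_M^h$ is chosen. For a symmetric positive definite matrix, $\lambda_{\min},\lambda_{\max}$ are its smallest and largest eigenvalues and $\kappa_2=\lambda_{\max}/\lambda_{\min}$ is its spectral condition number (not to be confused with the coefficient $\kappa$). *)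

theory Defs
  imports "HOL-Analysis.Analysis" "Jordan_Normal_Form.Spectral_Radius"
begin

section \<open>The Sobolev space on the unit square\<close>

definition Omega :: "(real \<times> real) set" where
  "Omega = {0<..<1} \<times> {0<..<1}"

definition L2 :: "(real \<times> real \<Rightarrow> 'b::euclidean_space) set" where
  "L2 = {f \<in> borel_measurable (lebesgue_on Omega).
           integrable (lebesgue_on Omega) (\<lambda>p. (norm (f p))\<^sup>2)}"

fun Ck :: "nat \<Rightarrow> (real \<times> real \<Rightarrow> real) \<Rightarrow> bool" where
  "Ck 0 f \<longleftrightarrow> continuous_on UNIV f"
| "Ck (Suc k) f \<longleftrightarrow>
     (\<exists>g. (\<forall>p. GDERIV f p :> g p) \<and> Ck k (\<lambda>p. fst (g p)) \<and> Ck k (\<lambda>p. snd (g p)))"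

definition test_fun :: "(real \<times> real \<Rightarrow> real) set" where
  "test_fun = {f. (\<forall>k. Ck k f) \<and> compact (closure {p. f p \<noteq> 0}) \<and> closure {p. f p \<noteq> 0} \<subseteq> Omega}"

definition classical_grad :: "(real \<times> real \<Rightarrow> real) \<Rightarrow> real \<times> real \<Rightarrow> real \<times> real" where
  "classical_grad f p = (THE D. GDERIV f p :> D)"

text \<open>Both components of the integration by parts formula are stated at once, as an equation between
  vector-valued integrals.\<close>

definition has_weak_grad ::
  "(real \<times> real \<Rightarrow> real) \<Rightarrow> (real \<times> real \<Rightarrow> real \<times> real) \<Rightarrow> bool" where
  "has_weak_grad u g \<longleftrightarrow> u \<in> L2 \<and> g \<in> L2 \<and>
     (\<forall>\<phi>\<in>test_fun. (LINT p|lebesgue_on Omega. u p *\<^sub>R classical_grad \<phi> p)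
                    = - (LINT p|lebesgue_on Omega. \<phi> p *\<^sub>R g p))"

text \<open>\<open>h01_grad u g\<close>: \<open>u\<close> has the weak gradient \<open>g\<close> and lies in the closure of the test functions with
  respect to the full norm of \<open>H\<^sup>1\<close>. The gradient \<open>g\<close> is determined by \<open>u\<close> almost everywhere.\<close>

definition h01_grad ::
  "(real \<times> real \<Rightarrow> real) \<Rightarrow> (real \<times> real \<Rightarrow> real \<times> real) \<Rightarrow> bool" where
  "h01_grad u g \<longleftrightarrow> has_weak_grad u g \<and>
     (\<forall>e>0. \<exists>\<phi>\<in>test_fun.
        (LINT p|lebesgue_on Omega. (u p - \<phi> p)\<^sup>2)
        + (LINT p|lebesgue_on Omega. (norm (g p - classical_grad \<phi> p))\<^sup>2) < e)"

definition H01_fun :: "(real \<times> real \<Rightarrow> real) \<Rightarrow> bool" where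
  "H01_fun u \<longleftrightarrow> (\<exists>g. h01_grad u g)"

subsection \<open>Closure properties\<close>

lemma L2_measurable: "f \<in> L2 \<Longrightarrow> f \<in> borel_measurable (lebesgue_on Omega)"
  and L2_integrable: "f \<in> L2 \<Longrightarrow> integrable (lebesgue_on Omega) (\<lambda>p. (norm (f p))\<^sup>2)"
  by (simp_all add: L2_def)

lemma norm_add_sq_le:
  fixes a b :: "'b::real_inner"
  shows "(norm (a + b))\<^sup>2 \<le> 2 * ((norm a)\<^sup>2 + (norm b)\<^sup>2)"
proof -
  have "(norm (a + b))\<^sup>2 \<le> (norm a + norm b)\<^sup>2"
    by (intro power_mono norm_triangle_ineq) auto
  also have "\<dots> \<le> 2 * ((norm a)\<^sup>2 + (norm b)\<^sup>2)"
    using zero_le_power2[of "norm a - norm b"] by (simp add: power2_eq_square algebra_simps)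
  finally show ?thesis .
qed

lemma L2_add:
  fixes f g :: "real \<times> real \<Rightarrow> 'b::euclidean_space"
  assumes "f \<in> L2" "g \<in> L2"
  shows "(\<lambda>p. f p + g p) \<in> L2"
proof -
  have m: "f \<in> borel_measurable (lebesgue_on Omega)" "g \<in> borel_measurable (lebesgue_on Omega)"
    using assms by (auto simp: L2_measurable)
  have "integrable (lebesgue_on Omega) (\<lambda>p. 2 * ((norm (f p))\<^sup>2 + (norm (g p))\<^sup>2))"
    using assms by (intro integrable_mult_right Bochner_Integration.integrable_add) (auto simp: L2_integrable)
  then have "integrable (lebesgue_on Omega) (\<lambda>p. (norm (f p + g p))\<^sup>2)"
    by (rule Bochner_Integration.integrable_bound) (use m norm_add_sq_le in \<open>auto intro!: AE_I2\<close>)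
  then show ?thesis
    using m by (auto simp: L2_def)
qed

lemma L2_scaleR:
  fixes f :: "real \<times> real \<Rightarrow> 'b::euclidean_space"
  assumes "f \<in> L2"
  shows "(\<lambda>p. c *\<^sub>R f p) \<in> L2"
  using assms by (auto simp: L2_def power_mult_distrib)

lemma L2_diff:
  fixes f g :: "real \<times> real \<Rightarrow> 'b::euclidean_space"
  assumes "f \<in> L2" "g \<in> L2"
  shows "(\<lambda>p. f p - g p) \<in> L2"
  using L2_add[OF assms(1) L2_scaleR[OF assms(2), of "-1"]] by simp

lemma L2_scaleR_integrable:
  fixes f :: "real \<times> real \<Rightarrow> real" and g :: "real \<times> real \<Rightarrow> 'b::euclidean_space"
  assumes "f \<in> L2" "g \<in> L2"
  shows "integrable (lebesgue_on Omega) (\<lambda>p. f p *\<^sub>R g p)"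
proof -
  have m: "f \<in> borel_measurable (lebesgue_on Omega)" "g \<in> borel_measurable (lebesgue_on Omega)"
    using assms by (auto simp: L2_measurable)
  have i: "integrable (lebesgue_on Omega) (\<lambda>p. (norm (f p))\<^sup>2 + (norm (g p))\<^sup>2)"
    by (intro Bochner_Integration.integrable_add L2_integrable assms)
  have b: "norm (f p *\<^sub>R g p) \<le> norm ((norm (f p))\<^sup>2 + (norm (g p))\<^sup>2)" for p
  proof -
    have "0 \<le> \<bar>f p\<bar> * norm (g p)" by simp
    moreover have "2 * (\<bar>f p\<bar> * norm (g p)) \<le> (norm (f p))\<^sup>2 + (norm (g p))\<^sup>2"
      using zero_le_power2[of "\<bar>f p\<bar> - norm (g p)"] by (simp add: power2_eq_square algebra_simps)
    ultimately have "\<bar>f p\<bar> * norm (g p) \<le> (norm (f p))\<^sup>2 + (norm (g p))\<^sup>2" by linarith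
    then show ?thesis by simp
  qed
  show ?thesis
    by (rule Bochner_Integration.integrable_bound[OF i]) (use m b in \<open>auto intro!: AE_I2\<close>)
qed

lemma Omega_lmeasurable: "Omega \<in> lmeasurable"
proof -
  have "Omega = box (0,0) (1,1)"
    by (auto simp: Omega_def box_def Basis_prod_def)
  then show ?thesis using lmeasurable_open[OF bounded_box open_box] by metis
qed

lemma bounded_cont_L2:
  fixes f :: "real \<times> real \<Rightarrow> 'b::euclidean_space"
  assumes c: "continuous_on UNIV f" and b: "\<And>p. norm (f p) \<le> B"
  shows "f \<in> L2"
proof -
  have f: "f \<in> borel_measurable borel"
    using c by (rule borel_measurable_continuous_onI)
  have m: "f \<in> borel_measurable (lebesgue_on Omega)"
    using f by (intro measurable_restrict_space1 measurable_completion) simp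
  have "integrable (lebesgue_on Omega) (\<lambda>p. B\<^sup>2)"
    by (rule finite_measure.integrable_const[OF finite_measure_lebesgue_on[OF Omega_lmeasurable]])
  then have "integrable (lebesgue_on Omega) (\<lambda>p. (norm (f p))\<^sup>2)"
    by (rule Bochner_Integration.integrable_bound) (use m b in \<open>auto intro!: AE_I2 power_mono\<close>)
  then show ?thesis
    using m by (auto simp: L2_def)
qed

lemma GDERIV_unique:
  assumes "GDERIV f p :> D" "GDERIV f p :> (E :: 'a :: real_inner)"
  shows "D = E"
proof -
  have "inner h D = inner h E" for h
    using has_derivative_unique[OF assms[unfolded gderiv_def]] by metis
  then show ?thesis by (metis vector_eq_ldot)
qed

lemma classical_grad_eqI: "GDERIV f p :> D \<Longrightarrow> classical_grad f p = D"
  unfolding classical_grad_def by (rule the_equality) (auto intro: GDERIV_unique)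

lemma Ck_zero: "Ck k (\<lambda>_. 0)"
  by (induction k) (auto intro!: exI[of _ "\<lambda>_. 0"] GDERIV_const)

lemma Ck_add: "Ck k f \<Longrightarrow> Ck k g \<Longrightarrow> Ck k (\<lambda>p. f p + g p)"
proof (induction k arbitrary: f g)
  case (Suc k)
  then obtain f' g' where "\<forall>p. GDERIV f p :> f' p" "Ck k (\<lambda>p. fst (f' p))" "Ck k (\<lambda>p. snd (f' p))"
    "\<forall>p. GDERIV g p :> g' p" "Ck k (\<lambda>p. fst (g' p))" "Ck k (\<lambda>p. snd (g' p))" by auto
  with Suc.IH show ?case
    by (auto intro!: exI[of _ "\<lambda>p. f' p + g' p"] GDERIV_add)
qed (auto intro: continuous_intros)

lemma Ck_cmult: "Ck k f \<Longrightarrow> Ck k (\<lambda>p. c * f p)"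
proof (induction k arbitrary: f)
  case (Suc k)
  then obtain f' where f': "\<forall>p. GDERIV f p :> f' p" "Ck k (\<lambda>p. fst (f' p))" "Ck k (\<lambda>p. snd (f' p))"
    by auto
  have "GDERIV (\<lambda>p. c * f p) p :> c *\<^sub>R f' p" for p
    using GDERIV_mult[OF GDERIV_const f'(1)[rule_format], of c p] by simp
  with f' Suc.IH show ?case
    by (auto intro!: exI[of _ "\<lambda>p. c *\<^sub>R f' p"])
qed (auto intro: continuous_intros)

lemma test_fun_GDERIV:
  assumes "f \<in> test_fun"
  shows "GDERIV f p :> classical_grad f p"
proof -
  have "Ck (Suc 0) f" using assms unfolding test_fun_def by blast
  then obtain g where "\<forall>p. GDERIV f p :> g p" by auto
  then show ?thesis using classical_grad_eqI by metis
qed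

lemma test_fun_grad_continuous:
  assumes "f \<in> test_fun"
  shows "continuous_on UNIV (classical_grad f)"
proof -
  have "Ck (Suc 0) f" using assms unfolding test_fun_def by blast
  then obtain g where g: "\<forall>p. GDERIV f p :> g p"
    "continuous_on UNIV (\<lambda>p. fst (g p))" "continuous_on UNIV (\<lambda>p. snd (g p))" by auto
  have "classical_grad f = (\<lambda>p. (fst (g p), snd (g p)))"
    using g(1) classical_grad_eqI by fastforce
  then show ?thesis using continuous_on_Pair[OF g(2,3)] by simp
qed

lemma test_fun_grad_zero:
  assumes "f \<in> test_fun" "p \<notin> closure {p. f p \<noteq> 0}"
  shows "classical_grad f p = 0"
proof (rule classical_grad_eqI)
  have "GDERIV (\<lambda>_. 0::real) p :> 0" by (rule GDERIV_const)
  then show "GDERIV f p :> 0"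
    unfolding gderiv_def
    by (rule has_derivative_transform_within_open[where s = "- closure {p. f p \<noteq> 0}"])
       (use assms(2) closure_subset[of "{p. f p \<noteq> 0}"] in auto)
qed

lemma compact_support_bounded:
  fixes f :: "real \<times> real \<Rightarrow> 'b::euclidean_space"
  assumes "continuous_on UNIV f" "compact K" "\<And>p. p \<notin> K \<Longrightarrow> f p = 0"
  shows "\<exists>B. \<forall>p. norm (f p) \<le> B"
proof -
  have "compact (f ` K)"
    using assms by (intro compact_continuous_image continuous_on_subset[OF assms(1)]) auto
  then obtain B where "\<forall>x\<in>f ` K. norm x \<le> B"
    using compact_imp_bounded bounded_iff by metis
  then have "norm (f p) \<le> max B 0" for p
    using assms(3)[of p] by (cases "p \<in> K") (auto simp: le_max_iff_disj)
  then show ?thesis by blast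
qed

lemma test_fun_L2:
  assumes "f \<in> test_fun"
  shows "f \<in> L2" "classical_grad f \<in> L2"
proof -
  let ?K = "closure {p. f p \<noteq> 0}"
  have K: "compact ?K" using assms by (simp add: test_fun_def)
  have "Ck 0 f" using assms unfolding test_fun_def by blast
  then have c: "continuous_on UNIV f" by simp
  have z: "f p = 0" if "p \<notin> ?K" for p
    using that closure_subset[of "{p. f p \<noteq> 0}"] by auto
  show "f \<in> L2"
    using compact_support_bounded[OF c K z] bounded_cont_L2[OF c] by blast
  show "classical_grad f \<in> L2"
    using compact_support_bounded[OF test_fun_grad_continuous[OF assms] K test_fun_grad_zero[OF assms]]
      bounded_cont_L2[OF test_fun_grad_continuous[OF assms]] by blast
qed

lemma test_fun_zero: "(\<lambda>_. 0) \<in> test_fun"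
  by (simp add: test_fun_def Ck_zero)

lemma test_fun_add:
  assumes "f \<in> test_fun" "g \<in> test_fun"
  shows "(\<lambda>p. f p + g p) \<in> test_fun"
proof -
  let ?S = "\<lambda>f :: real \<times> real \<Rightarrow> real. closure {p. f p \<noteq> 0}"
  have "{p. f p + g p \<noteq> 0} \<subseteq> {p. f p \<noteq> 0} \<union> {p. g p \<noteq> 0}" by auto
  then have s: "?S (\<lambda>p. f p + g p) \<subseteq> ?S f \<union> ?S g"
    using closure_mono by (subst closure_Un[symmetric]) blast
  moreover have "compact (?S f \<union> ?S g)"
    using assms by (auto simp: test_fun_def intro: compact_Un)
  ultimately have "compact (?S (\<lambda>p. f p + g p))"
    using s by (simp add: compact_eq_bounded_closed) (meson bounded_Un bounded_subset)
  then show ?thesis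
    using assms s by (auto simp: test_fun_def Ck_add)
qed

lemma test_fun_cmult:
  assumes "f \<in> test_fun"
  shows "(\<lambda>p. c * f p) \<in> test_fun"
proof (cases "c = 0")
  case False
  then show ?thesis using assms by (auto simp: test_fun_def Ck_cmult)
qed (simp add: test_fun_zero)

lemma classical_grad_zero: "classical_grad (\<lambda>_. 0) p = 0"
  by (intro classical_grad_eqI GDERIV_const)

lemma classical_grad_add:
  assumes "f \<in> test_fun" "g \<in> test_fun"
  shows "classical_grad (\<lambda>p. f p + g p) p = classical_grad f p + classical_grad g p"
  by (intro classical_grad_eqI GDERIV_add test_fun_GDERIV assms)

lemma classical_grad_cmult:
  assumes "f \<in> test_fun"
  shows "classical_grad (\<lambda>p. c * f p) p = c *\<^sub>R classical_grad f p"
  using GDERIV_mult[OF GDERIV_const test_fun_GDERIV[OF assms], of c p]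
  by (intro classical_grad_eqI) simp

lemma has_weak_gradD:
  assumes "has_weak_grad u g"
  shows "u \<in> L2" "g \<in> L2"
    "\<phi> \<in> test_fun \<Longrightarrow> (LINT p|lebesgue_on Omega. u p *\<^sub>R classical_grad \<phi> p)
       = - (LINT p|lebesgue_on Omega. \<phi> p *\<^sub>R g p)"
  using assms unfolding has_weak_grad_def by (elim conjE; blast)+

lemma h01_gradD: "h01_grad u g \<Longrightarrow> has_weak_grad u g"
  unfolding h01_grad_def by (rule conjunct1)

lemma has_weak_grad_add:
  assumes "has_weak_grad u g" "has_weak_grad v k"
  shows "has_weak_grad (\<lambda>p. u p + v p) (\<lambda>p. g p + k p)"
proof -
  have L: "u \<in> L2" "v \<in> L2" "g \<in> L2" "k \<in> L2"
    by (rule has_weak_gradD[OF assms(1)] has_weak_gradD[OF assms(2)])+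
  have "(LINT p|lebesgue_on Omega. (u p + v p) *\<^sub>R classical_grad \<phi> p)
      = - (LINT p|lebesgue_on Omega. \<phi> p *\<^sub>R (g p + k p))" if \<phi>: "\<phi> \<in> test_fun" for \<phi>
  proof -
    note T = test_fun_L2[OF \<phi>]
    have "(LINT p|lebesgue_on Omega. (u p + v p) *\<^sub>R classical_grad \<phi> p)
        = (LINT p|lebesgue_on Omega. u p *\<^sub>R classical_grad \<phi> p)
        + (LINT p|lebesgue_on Omega. v p *\<^sub>R classical_grad \<phi> p)"
      unfolding scaleR_add_left
      by (rule Bochner_Integration.integral_add[OF L2_scaleR_integrable[OF L(1) T(2)]
            L2_scaleR_integrable[OF L(2) T(2)]])
    moreover have "(LINT p|lebesgue_on Omega. \<phi> p *\<^sub>R (g p + k p))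
        = (LINT p|lebesgue_on Omega. \<phi> p *\<^sub>R g p) + (LINT p|lebesgue_on Omega. \<phi> p *\<^sub>R k p)"
      unfolding scaleR_add_right
      by (rule Bochner_Integration.integral_add[OF L2_scaleR_integrable[OF T(1) L(3)]
            L2_scaleR_integrable[OF T(1) L(4)]])
    moreover have "(LINT p|lebesgue_on Omega. u p *\<^sub>R classical_grad \<phi> p)
        = - (LINT p|lebesgue_on Omega. \<phi> p *\<^sub>R g p)"
      by (rule has_weak_gradD(3)[OF assms(1) \<phi>])
    moreover have "(LINT p|lebesgue_on Omega. v p *\<^sub>R classical_grad \<phi> p)
        = - (LINT p|lebesgue_on Omega. \<phi> p *\<^sub>R k p)"
      by (rule has_weak_gradD(3)[OF assms(2) \<phi>])
    ultimately show ?thesis by simp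
  qed
  then show ?thesis
    unfolding has_weak_grad_def by (intro conjI ballI L2_add[OF L(1,2)] L2_add[OF L(3,4)])
qed

lemma has_weak_grad_scale:
  assumes "has_weak_grad u g"
  shows "has_weak_grad (\<lambda>p. c * u p) (\<lambda>p. c *\<^sub>R g p)"
proof -
  have L: "u \<in> L2" "g \<in> L2"
    by (rule has_weak_gradD[OF assms])+
  have "(LINT p|lebesgue_on Omega. (c * u p) *\<^sub>R classical_grad \<phi> p)
      = - (LINT p|lebesgue_on Omega. \<phi> p *\<^sub>R (c *\<^sub>R g p))" if \<phi>: "\<phi> \<in> test_fun" for \<phi>
  proof -
    have "(LINT p|lebesgue_on Omega. (c * u p) *\<^sub>R classical_grad \<phi> p)
        = (LINT p|lebesgue_on Omega. c *\<^sub>R (u p *\<^sub>R classical_grad \<phi> p))" by simp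
    also have "\<dots> = c *\<^sub>R (LINT p|lebesgue_on Omega. u p *\<^sub>R classical_grad \<phi> p)"
      by (rule integral_scaleR_right)
    also have "(LINT p|lebesgue_on Omega. u p *\<^sub>R classical_grad \<phi> p)
        = - (LINT p|lebesgue_on Omega. \<phi> p *\<^sub>R g p)"
      by (rule has_weak_gradD(3)[OF assms \<phi>])
    also have "c *\<^sub>R - (LINT p|lebesgue_on Omega. \<phi> p *\<^sub>R g p)
        = - (c *\<^sub>R (LINT p|lebesgue_on Omega. \<phi> p *\<^sub>R g p))"
      by (rule scaleR_minus_right)
    also have "c *\<^sub>R (LINT p|lebesgue_on Omega. \<phi> p *\<^sub>R g p)
        = (LINT p|lebesgue_on Omega. c *\<^sub>R (\<phi> p *\<^sub>R g p))"
      by (rule integral_scaleR_right[symmetric])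
    finally show ?thesis by (simp add: mult.commute)
  qed
  then show ?thesis
    unfolding has_weak_grad_def
    by (intro conjI ballI L2_scaleR[OF L(1), of c, simplified] L2_scaleR[OF L(2)])
qed

lemma L2_dist_add:
  fixes f g :: "real \<times> real \<Rightarrow> 'b::euclidean_space"
  assumes "f \<in> L2" "g \<in> L2"
  shows "(LINT p|lebesgue_on Omega. (norm (f p + g p))\<^sup>2)
    \<le> 2 * ((LINT p|lebesgue_on Omega. (norm (f p))\<^sup>2) + (LINT p|lebesgue_on Omega. (norm (g p))\<^sup>2))"
proof -
  have "(LINT p|lebesgue_on Omega. (norm (f p + g p))\<^sup>2)
      \<le> (LINT p|lebesgue_on Omega. 2 * ((norm (f p))\<^sup>2 + (norm (g p))\<^sup>2))"
    by (intro integral_mono norm_add_sq_le L2_integrable L2_add integrable_mult_right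
        Bochner_Integration.integrable_add assms)
  also have "\<dots> = 2 * ((LINT p|lebesgue_on Omega. (norm (f p))\<^sup>2) + (LINT p|lebesgue_on Omega. (norm (g p))\<^sup>2))"
    using assms by (simp add: L2_integrable)
  finally show ?thesis .
qed

lemma h01_grad_add:
  assumes "h01_grad u g" "h01_grad v k"
  shows "h01_grad (\<lambda>p. u p + v p) (\<lambda>p. g p + k p)"
  unfolding h01_grad_def
proof (intro conjI allI impI)
  show "has_weak_grad (\<lambda>p. u p + v p) (\<lambda>p. g p + k p)"
    by (rule has_weak_grad_add[OF h01_gradD[OF assms(1)] h01_gradD[OF assms(2)]])
  have L: "u \<in> L2" "v \<in> L2" "g \<in> L2" "k \<in> L2"
    by (rule has_weak_gradD[OF h01_gradD[OF assms(1)]] has_weak_gradD[OF h01_gradD[OF assms(2)]])+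
  fix e :: real assume "e > 0"
  then have e: "e / 4 > 0" by simp
  obtain \<phi> where \<phi>: "\<phi> \<in> test_fun" "(LINT p|lebesgue_on Omega. (u p - \<phi> p)\<^sup>2)
        + (LINT p|lebesgue_on Omega. (norm (g p - classical_grad \<phi> p))\<^sup>2) < e / 4"
    using assms(1) e unfolding h01_grad_def by blast
  obtain \<psi> where \<psi>: "\<psi> \<in> test_fun" "(LINT p|lebesgue_on Omega. (v p - \<psi> p)\<^sup>2)
        + (LINT p|lebesgue_on Omega. (norm (k p - classical_grad \<psi> p))\<^sup>2) < e / 4"
    using assms(2) e unfolding h01_grad_def by blast
  have arith: "x + y < e" if "x \<le> 2 * (a + b)" "y \<le> 2 * (c + d)" "a + c < e / 4" "b + d < e / 4"
    for a b c d x y :: real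
  proof -
    have "4 * (e / 4) = e" by simp
    then show ?thesis using that by argo
  qed
  note T = test_fun_L2[OF \<phi>(1)] test_fun_L2[OF \<psi>(1)]
  have eq: "u p + v p - (\<phi> p + \<psi> p) = (u p - \<phi> p) + (v p - \<psi> p)"
    "g p + k p - classical_grad (\<lambda>p. \<phi> p + \<psi> p) p
      = (g p - classical_grad \<phi> p) + (k p - classical_grad \<psi> p)" for p
    by (simp_all add: classical_grad_add \<phi> \<psi>)
  have "(LINT p|lebesgue_on Omega. ((u p - \<phi> p) + (v p - \<psi> p))\<^sup>2)
      \<le> 2 * ((LINT p|lebesgue_on Omega. (u p - \<phi> p)\<^sup>2) + (LINT p|lebesgue_on Omega. (v p - \<psi> p)\<^sup>2))"
    using L2_dist_add[OF L2_diff[OF L(1) T(1)] L2_diff[OF L(2) T(3)]] by simp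
  moreover have "(LINT p|lebesgue_on Omega. (norm ((g p - classical_grad \<phi> p) + (k p - classical_grad \<psi> p)))\<^sup>2)
      \<le> 2 * ((LINT p|lebesgue_on Omega. (norm (g p - classical_grad \<phi> p))\<^sup>2)
          + (LINT p|lebesgue_on Omega. (norm (k p - classical_grad \<psi> p))\<^sup>2))"
    by (rule L2_dist_add[OF L2_diff[OF L(3) T(2)] L2_diff[OF L(4) T(4)]])
  ultimately have "(LINT p|lebesgue_on Omega. (u p + v p - (\<phi> p + \<psi> p))\<^sup>2)
        + (LINT p|lebesgue_on Omega. (norm (g p + k p - classical_grad (\<lambda>p. \<phi> p + \<psi> p) p))\<^sup>2) < e"
    unfolding eq using \<phi>(2) \<psi>(2) by (rule arith)
  note F = this test_fun_add[OF \<phi>(1) \<psi>(1)]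
  show "\<exists>\<eta>\<in>test_fun. (LINT p|lebesgue_on Omega. (u p + v p - \<eta> p)\<^sup>2)
        + (LINT p|lebesgue_on Omega. (norm (g p + k p - classical_grad \<eta> p))\<^sup>2) < e"
    by (rule bexI[where x = "\<lambda>p. \<phi> p + \<psi> p"]) (rule F)+
qed

lemma h01_grad_scale:
  assumes "h01_grad u g"
  shows "h01_grad (\<lambda>p. c * u p) (\<lambda>p. c *\<^sub>R g p)"
  unfolding h01_grad_def
proof (intro conjI allI impI)
  show "has_weak_grad (\<lambda>p. c * u p) (\<lambda>p. c *\<^sub>R g p)"
    by (rule has_weak_grad_scale[OF h01_gradD[OF assms]])
  fix e :: real assume "e > 0"
  moreover have c: "c\<^sup>2 + 1 > 0" by (simp add: add_nonneg_pos)
  ultimately have e: "e / (c\<^sup>2 + 1) > 0" by simp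
  obtain \<phi> where \<phi>: "\<phi> \<in> test_fun" "(LINT p|lebesgue_on Omega. (u p - \<phi> p)\<^sup>2)
        + (LINT p|lebesgue_on Omega. (norm (g p - classical_grad \<phi> p))\<^sup>2) < e / (c\<^sup>2 + 1)"
    using assms(1) e unfolding h01_grad_def by blast
  define d where "d = (LINT p|lebesgue_on Omega. (u p - \<phi> p)\<^sup>2)
        + (LINT p|lebesgue_on Omega. (norm (g p - classical_grad \<phi> p))\<^sup>2)"
  have eq: "(c * u p - c * \<phi> p)\<^sup>2 = c\<^sup>2 * (u p - \<phi> p)\<^sup>2"
    "(norm (c *\<^sub>R g p - classical_grad (\<lambda>p. c * \<phi> p) p))\<^sup>2 = c\<^sup>2 * (norm (g p - classical_grad \<phi> p))\<^sup>2" for p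
  proof -
    have "c *\<^sub>R g p - classical_grad (\<lambda>p. c * \<phi> p) p = c *\<^sub>R (g p - classical_grad \<phi> p)"
      by (simp add: classical_grad_cmult \<phi> scaleR_diff_right)
    then show "(norm (c *\<^sub>R g p - classical_grad (\<lambda>p. c * \<phi> p) p))\<^sup>2 = c\<^sup>2 * (norm (g p - classical_grad \<phi> p))\<^sup>2"
      by (simp add: power_mult_distrib)
  qed (simp add: power_mult_distrib flip: right_diff_distrib)
  have "d \<ge> 0" by (simp add: d_def)
  then have "c\<^sup>2 * d \<le> (c\<^sup>2 + 1) * d" by (simp add: mult_right_mono)
  also have "\<dots> < e" using \<phi>(2) c by (simp add: d_def field_simps)
  finally have "(LINT p|lebesgue_on Omega. (c * u p - c * \<phi> p)\<^sup>2)
        + (LINT p|lebesgue_on Omega. (norm (c *\<^sub>R g p - classical_grad (\<lambda>p. c * \<phi> p) p))\<^sup>2) < e"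
    unfolding eq by (simp add: d_def distrib_left)
  note F = this test_fun_cmult[OF \<phi>(1)]
  show "\<exists>\<eta>\<in>test_fun. (LINT p|lebesgue_on Omega. (c * u p - \<eta> p)\<^sup>2)
        + (LINT p|lebesgue_on Omega. (norm (c *\<^sub>R g p - classical_grad \<eta> p))\<^sup>2) < e"
    by (rule bexI[where x = "\<lambda>p. c * \<phi> p"]) (rule F)+
qed

lemma h01_grad_zero: "h01_grad (\<lambda>_. 0) (\<lambda>_. 0)"
  unfolding h01_grad_def has_weak_grad_def
  by (auto simp: L2_def classical_grad_zero intro!: bexI[OF _ test_fun_zero])

lemma H01_fun_zero: "H01_fun (\<lambda>_. 0)"
  and H01_fun_add: "H01_fun u \<Longrightarrow> H01_fun v \<Longrightarrow> H01_fun (\<lambda>p. u p + v p)"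
  and H01_fun_scale: "H01_fun u \<Longrightarrow> H01_fun (\<lambda>p. c * u p)"
  unfolding H01_fun_def using h01_grad_zero h01_grad_add h01_grad_scale by blast+

section \<open>The vector space of classes of almost everywhere equal functions\<close>

quotient_type h01 = "real \<times> real \<Rightarrow> real" / partial:
  "\<lambda>u v. H01_fun u \<and> H01_fun v \<and> (AE p in lebesgue_on Omega. u p = v p)"
proof (rule part_equivpI)
  show "\<exists>u. H01_fun u \<and> H01_fun u \<and> (AE p in lebesgue_on Omega. u p = u p)"
    using H01_fun_zero by auto
  show "symp (\<lambda>u v. H01_fun u \<and> H01_fun v \<and> (AE p in lebesgue_on Omega. u p = v p))"
    by (auto intro!: sympI elim: eventually_mono)
  show "transp (\<lambda>u v. H01_fun u \<and> H01_fun v \<and> (AE p in lebesgue_on Omega. u p = v p))"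
    by (auto intro!: transpI elim: eventually_elim2)
qed

lemma h01_relI:
  assumes "H01_fun u" "\<And>p. u p = v p"
  shows "H01_fun u \<and> H01_fun v \<and> (AE p in lebesgue_on Omega. u p = v p)"
proof -
  have "v = u" using assms(2) by auto
  then show ?thesis using assms(1) by simp
qed

instantiation h01 :: real_vector
begin

lift_definition zero_h01 :: h01 is "\<lambda>_. 0"
  using H01_fun_zero by auto

lift_definition plus_h01 :: "h01 \<Rightarrow> h01 \<Rightarrow> h01" is "\<lambda>u v p. u p + v p"
  by (auto intro: H01_fun_add elim: eventually_elim2)

lift_definition scaleR_h01 :: "real \<Rightarrow> h01 \<Rightarrow> h01" is "\<lambda>c u p. c * u p"
  by (auto intro: H01_fun_scale elim: eventually_mono)

lift_definition uminus_h01 :: "h01 \<Rightarrow> h01" is "\<lambda>u p. (-1) * u p"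
  by (auto intro: H01_fun_scale[of _ "-1", simplified] elim: eventually_mono)

lift_definition minus_h01 :: "h01 \<Rightarrow> h01 \<Rightarrow> h01" is "\<lambda>u v p. u p + (-1) * v p"
proof -
  fix u u' v v' :: "real \<times> real \<Rightarrow> real"
  assume 1: "H01_fun u \<and> H01_fun u' \<and> (AE p in lebesgue_on Omega. u p = u' p)"
    and 2: "H01_fun v \<and> H01_fun v' \<and> (AE p in lebesgue_on Omega. v p = v' p)"
  have "AE p in lebesgue_on Omega. u p + (-1) * v p = u' p + (-1) * v' p"
    using 1 2 by (auto elim: eventually_elim2)
  then show "H01_fun (\<lambda>p. u p + (-1) * v p) \<and> H01_fun (\<lambda>p. u' p + (-1) * v' p) \<and>
      (AE p in lebesgue_on Omega. u p + (-1) * v p = u' p + (-1) * v' p)"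
    using 1 2 H01_fun_add H01_fun_scale by blast
qed

instance
proof
  fix a b :: real and x y z :: h01
  show "x + y + z = x + (y + z)"
    by transfer (intro h01_relI H01_fun_zero H01_fun_add H01_fun_scale; simp add: algebra_simps)
  show "x + y = y + x"
    by transfer (intro h01_relI H01_fun_zero H01_fun_add H01_fun_scale; simp add: algebra_simps)
  show "0 + x = x"
    by transfer (intro h01_relI H01_fun_zero H01_fun_add H01_fun_scale; simp add: algebra_simps)
  show "- x + x = 0"
    by transfer (intro h01_relI H01_fun_zero H01_fun_add H01_fun_scale; simp add: algebra_simps)
  show "x - y = x + - y"
    by transfer (intro h01_relI H01_fun_zero H01_fun_add H01_fun_scale; simp add: algebra_simps)
  show "a *\<^sub>R (x + y) = a *\<^sub>R x + a *\<^sub>R y"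
    by transfer (intro h01_relI H01_fun_zero H01_fun_add H01_fun_scale; simp add: algebra_simps)
  show "(a + b) *\<^sub>R x = a *\<^sub>R x + b *\<^sub>R x"
    by transfer (intro h01_relI H01_fun_zero H01_fun_add H01_fun_scale; simp add: algebra_simps)
  show "a *\<^sub>R b *\<^sub>R x = (a * b) *\<^sub>R x"
    by transfer (intro h01_relI H01_fun_zero H01_fun_add H01_fun_scale; simp add: algebra_simps)
  show "1 *\<^sub>R x = x"
    by transfer (intro h01_relI H01_fun_zero H01_fun_add H01_fun_scale; simp add: algebra_simps)
qed

end

section \<open>Inner product, bilinear form and spectral subspace\<close>

text \<open>\<open>grad u\<close> depends on the chosen representatives only up to null sets, which no integral below
  can see.\<close>

definition grad :: "h01 \<Rightarrow> real \<times> real \<Rightarrow> real \<times> real" where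
  "grad u = (SOME g. h01_grad (rep_h01 u) g)"

definition h01_inner :: "h01 \<Rightarrow> h01 \<Rightarrow> real" where
  "h01_inner u v = (LINT p|lebesgue_on Omega. inner (grad u p) (grad v p))"

definition h01_norm :: "h01 \<Rightarrow> real" where
  "h01_norm u = sqrt (h01_inner u u)"

definition coefficient :: "real \<Rightarrow> real \<Rightarrow> (real \<times> real \<Rightarrow> real) \<Rightarrow> bool" where
  "coefficient \<kappa>min \<kappa>max \<kappa> \<longleftrightarrow> \<kappa> \<in> borel_measurable (lebesgue_on Omega) \<and>
     0 < \<kappa>min \<and> (\<forall>p\<in>Omega. \<kappa>min \<le> \<kappa> p \<and> \<kappa> p \<le> \<kappa>max)"

definition energy_form :: "(real \<times> real \<Rightarrow> real) \<Rightarrow> h01 \<Rightarrow> h01 \<Rightarrow> real" where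
  "energy_form \<kappa> u v = (LINT p|lebesgue_on Omega. \<kappa> p * inner (grad u p) (grad v p))"

definition continuous_form :: "real \<Rightarrow> (h01 \<Rightarrow> h01 \<Rightarrow> real) \<Rightarrow> bool" where
  "continuous_form c b \<longleftrightarrow> (\<forall>u v. \<bar>b u v\<bar> \<le> c * h01_norm u * h01_norm v)"

definition coercive_form :: "real \<Rightarrow> (h01 \<Rightarrow> h01 \<Rightarrow> real) \<Rightarrow> bool" where
  "coercive_form \<alpha> b \<longleftrightarrow> (\<forall>u. \<alpha> * (h01_norm u)\<^sup>2 \<le> b u u)"

text \<open>The sine functions are smooth up to the boundary of the square and vanish there, hence they
  satisfy \<open>H01_fun\<close> and \<open>abs_h01\<close> is their equivalence class.\<close>

definition sine_mode :: "nat \<Rightarrow> nat \<Rightarrow> h01" where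
  "sine_mode m n = abs_h01 (\<lambda>(x, y). sin (real m * pi * x) * sin (real n * pi * y))"

definition spectral_space :: "nat \<Rightarrow> h01 set" where
  "spectral_space M = span {sine_mode m n | m n. m \<in> {1..M} \<and> n \<in> {1..M}}"

definition fin_dim_subspace :: "'v::real_vector set \<Rightarrow> bool" where
  "fin_dim_subspace V \<longleftrightarrow> (\<exists>B. finite B \<and> V = span B)"

text \<open>A linear projection onto \<open>V\<close> with domain \<open>D\<close>. The domain need not be the whole space: nodal
  interpolation is only defined on those classes that have a continuous representative.\<close>

definition projection_onto :: "('v::real_vector \<Rightarrow> 'v) \<Rightarrow> 'v set \<Rightarrow> 'v set \<Rightarrow> bool" where
  "projection_onto P D V \<longleftrightarrow> Real_Vector_Spaces.subspace D \<and> V \<subseteq> D \<and>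
     (\<forall>u\<in>D. \<forall>v\<in>D. P (u + v) = P u + P v) \<and> (\<forall>r. \<forall>u\<in>D. P (r *\<^sub>R u) = r *\<^sub>R P u) \<and>
     P ` D \<subseteq> V \<and> (\<forall>v\<in>V. P v = v)"

definition basis_family :: "nat \<Rightarrow> (nat \<Rightarrow> 'v::real_vector) \<Rightarrow> 'v set \<Rightarrow> bool" where
  "basis_family K \<psi> W \<longleftrightarrow>
     inj_on \<psi> {..<K} \<and> independent (\<psi> ` {..<K}) \<and> span (\<psi> ` {..<K}) = W"

section \<open>Matrices and condition numbers\<close>

definition form_matrix :: "nat \<Rightarrow> ('v \<Rightarrow> 'v \<Rightarrow> real) \<Rightarrow> (nat \<Rightarrow> 'v) \<Rightarrow> real mat" where
  "form_matrix K b \<psi> = mat K K (\<lambda>(i, j). b (\<psi> j) (\<psi> i))"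

definition sym_pos_def :: "real mat \<Rightarrow> bool" where
  "sym_pos_def A \<longleftrightarrow> square_mat A \<and> transpose_mat A = A \<and>
     (\<forall>x\<in>carrier_vec (dim_row A). x \<noteq> 0\<^sub>v (dim_row A) \<longrightarrow> 0 < scalar_prod x (A *\<^sub>v x))"

text \<open>Meaningful for symmetric matrices of positive dimension, whose real spectrum is finite and
  nonempty.\<close>

definition lambda_max :: "real mat \<Rightarrow> real" where
  "lambda_max A = Max (spectrum A)"

definition lambda_min :: "real mat \<Rightarrow> real" where
  "lambda_min A = Min (spectrum A)"

definition cond2 :: "real mat \<Rightarrow> real" where
  "cond2 A = lambda_max A / lambda_min A"

end

theory Submission
  imports Defs
begin

text \<open>For \<open>x\<close> the coordinate vector of \<open>v\<close>, the quadratic forms of the two matrices are \<open>a(v, v)\<close> and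
  \<open>(v, v)\<close>, so continuity and coercivity compare them up to the factors \<open>c\<close> and \<open>\<alpha>\<close>, and Rayleigh quotients
  transfer this comparison to the extreme eigenvalues. That \<open>v \<mapsto> grad v\<close> is linear and injective almost
  everywhere needs neither the fundamental lemma of the calculus of variations nor Fubini's theorem. The
  components of \<open>grad \<phi>\<close> are again test functions, so a weak gradient of \<open>0\<close> is orthogonal to every
  \<open>grad \<phi>\<close>, hence to the limit of these, which is itself. If \<open>grad u = 0\<close>, then testing \<open>u\<close> with \<open>x \<phi>\<close>, where
  \<open>\<phi>\<close> is close to \<open>u\<close> in \<open>H\<^sup>1\<close>, gives \<open>0 = \<integral> u (\<phi> + x \<partial>\<^sub>x \<phi>) \<approx> \<integral> u\<^sup>2\<close>.\<close>

section \<open>Extreme eigenvalues of real symmetric matrices\<close>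

lemma scalar_prod_self_nonneg: "0 \<le> scalar_prod x (x :: real vec)"
  unfolding scalar_prod_def by (intro sum_nonneg) simp

lemma scalar_prod_self_pos:
  assumes "x \<in> carrier_vec n" "x \<noteq> 0\<^sub>v n"
  shows "0 < scalar_prod x (x :: real vec)"
proof -
  obtain i where "i < n" "vec_index x i \<noteq> 0"
    using assms by (metis carrier_vecD eq_vecI index_zero_vec)
  then show ?thesis
    using assms unfolding scalar_prod_def by (intro sum_pos2[of _ i]) auto
qed

lemma scalar_prod_Cauchy_Schwarz:
  fixes x y :: "real vec"
  assumes "x \<in> carrier_vec n" "y \<in> carrier_vec n"
  shows "(scalar_prod x y)\<^sup>2 \<le> scalar_prod x x * scalar_prod y y"
  using assms Cauchy_Schwarz_ineq_sum[of "vec_index x" "vec_index y" "{0..<n}"]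
  by (simp add: scalar_prod_def power2_eq_square)

text \<open>Cauchy-Schwarz, applied row by row, bounds the squared length of
  \<open>A *\<^sub>v x\<close> by the squared Frobenius norm of \<open>A\<close> times that of
  \<open>x\<close>.\<close>

lemma mat_bounded:
  fixes A :: "real mat"
  assumes A: "A \<in> carrier_mat n k"
  obtains C where "C > 0"
    "\<And>x. x \<in> carrier_vec k \<Longrightarrow> scalar_prod (A *\<^sub>v x) (A *\<^sub>v x) \<le> C * scalar_prod x x"
proof
  \<comment> \<open>The summand 1 keeps the constant positive even for the zero matrix.\<close>
  let ?C = "1 + (\<Sum>i<n. scalar_prod (row A i) (row A i))"
  show "?C > 0"
    by (intro add_pos_nonneg sum_nonneg scalar_prod_self_nonneg) simp
  fix x :: "real vec" assume x: "x \<in> carrier_vec k"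
  have "scalar_prod (A *\<^sub>v x) (A *\<^sub>v x) = (\<Sum>i<n. (scalar_prod (row A i) x)\<^sup>2)"
    using A unfolding scalar_prod_def[of "A *\<^sub>v x"]
    by (auto simp: power2_eq_square atLeast0LessThan intro!: sum.cong)
  also have "\<dots> \<le> (\<Sum>i<n. scalar_prod (row A i) (row A i) * scalar_prod x x)"
    using A x by (intro sum_mono scalar_prod_Cauchy_Schwarz[of _ k]) auto
  also have "\<dots> = (\<Sum>i<n. scalar_prod (row A i) (row A i)) * scalar_prod x x"
    by (simp add: sum_distrib_right)
  also have "\<dots> \<le> ?C * scalar_prod x x"
    by (intro mult_right_mono scalar_prod_self_nonneg) simp
  finally show "scalar_prod (A *\<^sub>v x) (A *\<^sub>v x) \<le> ?C * scalar_prod x x" .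
qed

lemma scalar_prod_real_le:
  fixes x y :: "real vec"
  assumes x: "x \<in> carrier_vec n" and y: "y \<in> carrier_vec n"
  shows "\<bar>scalar_prod x y\<bar> \<le> scalar_prod x x + scalar_prod y y"
proof -
  have "\<bar>scalar_prod x y\<bar> \<le> (\<Sum>i\<in>{0..<n}. \<bar>vec_index x i * vec_index y i\<bar>)"
    using x y unfolding scalar_prod_def by (auto intro: sum_abs)
  also have "\<dots> \<le> (\<Sum>i\<in>{0..<n}. vec_index x i * vec_index x i + vec_index y i * vec_index y i)"
  proof (intro sum_mono)
    fix i
    have "2 * \<bar>vec_index x i * vec_index y i\<bar> \<le> (vec_index x i)\<^sup>2 + (vec_index y i)\<^sup>2"
      using zero_le_power2[of "\<bar>vec_index x i\<bar> - \<bar>vec_index y i\<bar>"]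
      by (simp add: power2_diff abs_mult)
    then show "\<bar>vec_index x i * vec_index y i\<bar> \<le> vec_index x i * vec_index x i + vec_index y i * vec_index y i"
      unfolding power2_eq_square by linarith
  qed
  also have "\<dots> = scalar_prod x x + scalar_prod y y"
    using x y by (simp add: scalar_prod_def sum.distrib)
  finally show ?thesis .
qed

lemma quadratic_form_bounded:
  fixes A :: "real mat"
  assumes A: "A \<in> carrier_mat n n"
  obtains L where "L > 0"
    "\<And>x. x \<in> carrier_vec n \<Longrightarrow> \<bar>scalar_prod x (A *\<^sub>v x)\<bar> \<le> L * scalar_prod x x"
proof -
  obtain C where C: "C > 0"
    "\<And>x. x \<in> carrier_vec n \<Longrightarrow> scalar_prod (A *\<^sub>v x) (A *\<^sub>v x) \<le> C * scalar_prod x x"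
    using mat_bounded[OF A] by blast
  have "\<bar>scalar_prod x (A *\<^sub>v x)\<bar> \<le> (1 + C) * scalar_prod x x" if x: "x \<in> carrier_vec n" for x
    using scalar_prod_real_le[OF x, of "A *\<^sub>v x"] C(2)[OF x] A x
    by (simp add: algebra_simps)
  then show ?thesis using that[of "1 + C"] C(1) by auto
qed

text \<open>The form is nonnegative at \<open>x - B x / L\<close>, where \<open>L\<close> bounds it on the unit sphere.\<close>

lemma psd_norm_image_le:
  fixes B :: "real mat"
  assumes B: "B \<in> carrier_mat n n" and sym: "transpose_mat B = B"
    and psd: "\<And>x. x \<in> carrier_vec n \<Longrightarrow> 0 \<le> scalar_prod x (B *\<^sub>v x)"
  obtains L where "L > 0"
    "\<And>x. x \<in> carrier_vec n \<Longrightarrow> scalar_prod (B *\<^sub>v x) (B *\<^sub>v x) \<le> L * scalar_prod x (B *\<^sub>v x)"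
proof -
  obtain L where L: "L > 0"
    "\<And>x. x \<in> carrier_vec n \<Longrightarrow> \<bar>scalar_prod x (B *\<^sub>v x)\<bar> \<le> L * scalar_prod x x"
    using quadratic_form_bounded[OF B] by blast
  have "scalar_prod (B *\<^sub>v x) (B *\<^sub>v x) \<le> L * scalar_prod x (B *\<^sub>v x)" if x: "x \<in> carrier_vec n" for x
  proof -
    define y where "y = B *\<^sub>v x"
    \<comment> \<open>With this \<open>t\<close> the quadratic term is at most
      \<open>- t * scalar_prod y y\<close>, which cancels half of the cross term
      \<open>2 * t * scalar_prod y y\<close>; what remains is the claim divided by
      \<open>L\<close>.\<close>
    define t where "t = - 1 / L"
    have y: "y \<in> carrier_vec n" and By: "B *\<^sub>v y \<in> carrier_vec n"
      using B x by (auto simp: y_def)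
    have xBy: "scalar_prod x (B *\<^sub>v y) = scalar_prod y y"
      using transpose_vec_mult_scalar[OF B y x] comm_scalar_prod[OF x By] comm_scalar_prod[OF y y] sym
      by (simp add: y_def)
    have "B *\<^sub>v (x + t \<cdot>\<^sub>v y) = y + t \<cdot>\<^sub>v (B *\<^sub>v y)"
      using B x y mult_add_distrib_mat_vec[OF B x, of "t \<cdot>\<^sub>v y"] by (simp add: y_def mult_mat_vec)
    then have "scalar_prod (x + t \<cdot>\<^sub>v y) (B *\<^sub>v (x + t \<cdot>\<^sub>v y))
        = scalar_prod x y + 2 * t * scalar_prod y y + t\<^sup>2 * scalar_prod y (B *\<^sub>v y)"
      using x y By xBy
      by (simp add: add_scalar_prod_distrib[of _ n] scalar_prod_add_distrib[of _ n]
          algebra_simps power2_eq_square)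
    moreover have "t\<^sup>2 * scalar_prod y (B *\<^sub>v y) \<le> t\<^sup>2 * (L * scalar_prod y y)"
      using L(2)[OF y] by (intro mult_left_mono) auto
    moreover have "t\<^sup>2 * (L * scalar_prod y y) = - t * scalar_prod y y"
      using L(1) by (simp add: t_def power2_eq_square)
    moreover have "0 \<le> scalar_prod (x + t \<cdot>\<^sub>v y) (B *\<^sub>v (x + t \<cdot>\<^sub>v y))"
      using x y by (intro psd) auto
    ultimately have "0 \<le> scalar_prod x y + t * scalar_prod y y" by linarith
    then show ?thesis using L(1) by (simp add: t_def field_simps flip: y_def)
  qed
  then show ?thesis using that L(1) by blast
qed

text \<open>Two bounds are chained: the inverse controls \<open>x\<close> by
  \<open>B *\<^sub>v x\<close>, and for a positive semidefinite matrix the form at \<open>x\<close>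
  controls \<open>B *\<^sub>v x\<close>.\<close>

lemma psd_det_nonzero_coercive:
  fixes B :: "real mat"
  assumes B: "B \<in> carrier_mat n n" and sym: "transpose_mat B = B"
    and psd: "\<And>x. x \<in> carrier_vec n \<Longrightarrow> 0 \<le> scalar_prod x (B *\<^sub>v x)"
    and det: "det B \<noteq> 0"
  obtains d where "d > 0"
    "\<And>x. x \<in> carrier_vec n \<Longrightarrow> d * scalar_prod x x \<le> scalar_prod x (B *\<^sub>v x)"
proof -
  obtain L where L: "L > 0"
    "\<And>x. x \<in> carrier_vec n \<Longrightarrow> scalar_prod (B *\<^sub>v x) (B *\<^sub>v x) \<le> L * scalar_prod x (B *\<^sub>v x)"
    using psd_norm_image_le[OF B sym psd] by blast
  \<comment> \<open>The inverse comes from \<open>B\<close> being a unit of the matrix ring;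
    \<open>()\<close> only fills the extension slot of the ring record.\<close>
  obtain N where N: "N \<in> carrier_mat n n" "N * B = 1\<^sub>m n"
    using det_non_zero_imp_unit[OF B det, of "()"] by (auto simp: Units_def ring_mat_def)
  obtain C where C: "C > 0"
    "\<And>x. x \<in> carrier_vec n \<Longrightarrow> scalar_prod (N *\<^sub>v x) (N *\<^sub>v x) \<le> C * scalar_prod x x"
    using mat_bounded[OF N(1)] by blast
  have "1 / (C * L) * scalar_prod x x \<le> scalar_prod x (B *\<^sub>v x)" if x: "x \<in> carrier_vec n" for x
  proof -
    have "N *\<^sub>v (B *\<^sub>v x) = x"
      using N B x by (simp flip: assoc_mult_mat_vec)
    then have "scalar_prod x x \<le> C * scalar_prod (B *\<^sub>v x) (B *\<^sub>v x)"
      using C(2)[of "B *\<^sub>v x"] B x by simp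
    also have "\<dots> \<le> C * (L * scalar_prod x (B *\<^sub>v x))"
      using C(1) L(2)[OF x] by simp
    finally show ?thesis using C(1) L(1) by (simp add: field_simps)
  qed
  then show ?thesis using that[of "1 / (C * L)"] C(1) L(1) by simp
qed

text \<open>The infimum \<open>m\<close> of the Rayleigh quotient is an eigenvalue: otherwise \<open>A - m I\<close> would be positive
  semidefinite and invertible, hence bounded below. No compactness of the sphere is needed.\<close>

lemma symmetric_min_eigenvalue:
  fixes A :: "real mat"
  assumes A: "A \<in> carrier_mat n n" and sym: "transpose_mat A = A" and n: "n > 0"
  obtains m where "eigenvalue A m"
    "\<And>x. x \<in> carrier_vec n \<Longrightarrow> m * scalar_prod x x \<le> scalar_prod x (A *\<^sub>v x)"
proof -
  define S where "S = {scalar_prod x (A *\<^sub>v x) / scalar_prod x x | x. x \<in> carrier_vec n \<and> x \<noteq> 0\<^sub>v n}"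
  define m where "m = Inf S"
  obtain L where L: "L > 0"
    "\<And>x. x \<in> carrier_vec n \<Longrightarrow> \<bar>scalar_prod x (A *\<^sub>v x)\<bar> \<le> L * scalar_prod x x"
    using quadratic_form_bounded[OF A] by blast
  \<comment> \<open>Positive dimension enters here: it provides a nonzero vector, without which the
    infimum would be unspecified.\<close>
  have ne: "S \<noteq> {}"
  proof -
    have "unit_vec n 0 \<noteq> (0\<^sub>v n :: real vec)"
      using n by (metis index_unit_vec(1) index_zero_vec(1) zero_neq_one)
    then show ?thesis unfolding S_def by (auto intro!: exI[of _ "unit_vec n 0"])
  qed
  have bdd: "bdd_below S"
  proof (rule bdd_belowI)
    fix r assume "r \<in> S"
    then obtain x where x: "x \<in> carrier_vec n" "x \<noteq> 0\<^sub>v n" "r = scalar_prod x (A *\<^sub>v x) / scalar_prod x x"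
      by (auto simp: S_def)
    then show "- L \<le> r"
      using L(2)[OF x(1)] scalar_prod_self_pos[OF x(1,2)] by (simp add: le_divide_eq abs_le_iff)
  qed
  have m: "m * scalar_prod x x \<le> scalar_prod x (A *\<^sub>v x)" if x: "x \<in> carrier_vec n" for x
  proof (cases "x = 0\<^sub>v n")
    case True
    then show ?thesis using A x by simp
  next
    case False
    then have "m \<le> scalar_prod x (A *\<^sub>v x) / scalar_prod x x"
      unfolding m_def using x by (intro cInf_lower bdd) (auto simp: S_def)
    then show ?thesis using scalar_prod_self_pos[OF x False] by (simp add: field_simps)
  qed
  \<comment> \<open>This is \<open>A\<close> minus \<open>m\<close> times the identity, singular
    exactly when \<open>m\<close> is an eigenvalue.\<close>
  define B where "B = char_matrix A m"
  have B: "B \<in> carrier_mat n n" "transpose_mat B = B"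
    using A sym by (auto simp: B_def char_matrix_def transpose_add)
  have Bx: "scalar_prod x (B *\<^sub>v x) = scalar_prod x (A *\<^sub>v x) - m * scalar_prod x x"
    if x: "x \<in> carrier_vec n" for x
  proof -
    have "B *\<^sub>v x = A *\<^sub>v x + (- m) \<cdot>\<^sub>v x"
      using A x unfolding B_def char_matrix_def
      by (subst add_mult_distrib_mat_vec[of _ n n])
         (auto intro!: eq_vecI arg_cong2[of _ _ _ _ plus])
    then show ?thesis using A x by (simp add: scalar_prod_add_distrib[of _ n])
  qed
  have "eigenvalue A m"
  proof (rule ccontr)
    assume "\<not> eigenvalue A m"
    then have "det B \<noteq> 0" using eigenvalue_det[OF A] by (simp add: B_def)
    then obtain d where d: "d > 0"
      "\<And>x. x \<in> carrier_vec n \<Longrightarrow> d * scalar_prod x x \<le> scalar_prod x (B *\<^sub>v x)"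
      using psd_det_nonzero_coercive[OF B] Bx m by (metis diff_ge_0_iff_ge)
    \<comment> \<open>A coercivity constant \<open>d\<close> of the shifted matrix lifts every
      Rayleigh quotient to at least \<open>m + d\<close>, above their greatest lower bound.\<close>
    have "m + d \<le> m"
      unfolding m_def
    proof (rule cInf_greatest[OF ne])
      fix r assume "r \<in> S"
      then obtain x where x: "x \<in> carrier_vec n" "x \<noteq> 0\<^sub>v n" "r = scalar_prod x (A *\<^sub>v x) / scalar_prod x x"
        by (auto simp: S_def)
      then show "Inf S + d \<le> r"
        using d(2)[OF x(1)] Bx[OF x(1)] scalar_prod_self_pos[OF x(1,2)]
        by (simp add: le_divide_eq distrib_right flip: m_def)
    qed
    then show False using d(1) by simp
  qed
  then show ?thesis using that m by blast
qed

lemma eigenvalue_uminus: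
  fixes A :: "real mat"
  assumes "A \<in> carrier_mat n n" "eigenvalue (- A) k"
  shows "eigenvalue A (- k)"
proof -
  obtain v where v: "v \<in> carrier_vec n" "v \<noteq> 0\<^sub>v n" "(- A) *\<^sub>v v = k \<cdot>\<^sub>v v"
    using assms by (auto simp: eigenvalue_def eigenvector_def)
  then have neg: "- (A *\<^sub>v v) = k \<cdot>\<^sub>v v" using assms(1) by simp
  have "A *\<^sub>v v = - (- (A *\<^sub>v v))" by simp
  also have "\<dots> = (- k) \<cdot>\<^sub>v v" unfolding neg by (intro eq_vecI) auto
  finally have "A *\<^sub>v v = (- k) \<cdot>\<^sub>v v" .
  then show ?thesis using assms(1) v by (auto simp: eigenvalue_def eigenvector_def)
qed

text \<open>This is the result on the minimum for \<open>- A\<close>, where the form and the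
  eigenvalues change sign.\<close>

lemma symmetric_max_eigenvalue:
  fixes A :: "real mat"
  assumes A: "A \<in> carrier_mat n n" and sym: "transpose_mat A = A" and n: "n > 0"
  obtains m where "eigenvalue A m"
    "\<And>x. x \<in> carrier_vec n \<Longrightarrow> scalar_prod x (A *\<^sub>v x) \<le> m * scalar_prod x x"
proof -
  have "transpose_mat (- A) = - A" using sym by (metis transpose_uminus)
  then obtain k where k: "eigenvalue (- A) k"
    "\<And>x. x \<in> carrier_vec n \<Longrightarrow> k * scalar_prod x x \<le> scalar_prod x (- A *\<^sub>v x)"
    using symmetric_min_eigenvalue[of "- A" n] A n by auto
  have "scalar_prod x (A *\<^sub>v x) \<le> - k * scalar_prod x x" if x: "x \<in> carrier_vec n" for x
    using k(2)[OF x] A x by simp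
  then show ?thesis using that eigenvalue_uminus[OF A k(1)] by blast
qed

text \<open>The eigenvalues that bound the Rayleigh quotient show that the finite spectrum is
  nonempty, so its \<open>Min\<close> and \<open>Max\<close> belong to it. Replacing them by these
  extremes only weakens the bounds, since \<open>scalar_prod x x\<close> is nonnegative.\<close>

lemma symmetric_spectrum:
  fixes A :: "real mat"
  assumes A: "A \<in> carrier_mat n n" and sym: "transpose_mat A = A" and n: "n > 0"
  shows "lambda_min A \<in> spectrum A" "lambda_max A \<in> spectrum A"
    "x \<in> carrier_vec n \<Longrightarrow> lambda_min A * scalar_prod x x \<le> scalar_prod x (A *\<^sub>v x)"
    "x \<in> carrier_vec n \<Longrightarrow> scalar_prod x (A *\<^sub>v x) \<le> lambda_max A * scalar_prod x x"
proof -
  note fin = card_finite_spectrum(1)[OF A]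
  obtain m where m: "m \<in> spectrum A"
    "\<And>x. x \<in> carrier_vec n \<Longrightarrow> m * scalar_prod x x \<le> scalar_prod x (A *\<^sub>v x)"
    using symmetric_min_eigenvalue[OF assms] unfolding spectrum_def by blast
  obtain k where k: "k \<in> spectrum A"
    "\<And>x. x \<in> carrier_vec n \<Longrightarrow> scalar_prod x (A *\<^sub>v x) \<le> k * scalar_prod x x"
    using symmetric_max_eigenvalue[OF assms] unfolding spectrum_def by blast
  show "lambda_min A \<in> spectrum A" "lambda_max A \<in> spectrum A"
    unfolding lambda_min_def lambda_max_def using fin m(1) by (auto intro: Min_in Max_in)
  show "lambda_min A * scalar_prod x x \<le> scalar_prod x (A *\<^sub>v x)" if x: "x \<in> carrier_vec n"
    using m(2)[OF x] mult_right_mono[OF Min_le[OF fin m(1)] scalar_prod_self_nonneg[of x]]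
    unfolding lambda_min_def by linarith
  show "scalar_prod x (A *\<^sub>v x) \<le> lambda_max A * scalar_prod x x" if x: "x \<in> carrier_vec n"
    using k(2)[OF x] mult_right_mono[OF Max_ge[OF fin k(1)] scalar_prod_self_nonneg[of x]]
    unfolding lambda_max_def by linarith
qed

section \<open>Eigenvectors and the comparison of condition numbers\<close>

lemma spectrumE:
  fixes A :: "real mat"
  assumes "A \<in> carrier_mat n n" "k \<in> spectrum A"
  obtains v where "v \<in> carrier_vec n" "scalar_prod v v > 0"
    "scalar_prod v (A *\<^sub>v v) = k * scalar_prod v v"
proof -
  obtain v where v: "v \<in> carrier_vec n" "v \<noteq> 0\<^sub>v n" "A *\<^sub>v v = k \<cdot>\<^sub>v v"
    using assms by (auto simp: spectrum_def eigenvalue_def eigenvector_def)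
  then show ?thesis using that scalar_prod_self_pos[OF v(1,2)] by auto
qed

lemma sym_pos_def_lambda_min_pos:
  assumes "sym_pos_def A" "dim_row A > 0"
  shows "0 < lambda_min A"
proof -
  let ?n = "dim_row A"
  have A: "A \<in> carrier_mat ?n ?n" "transpose_mat A = A"
    and pos: "\<And>x. x \<in> carrier_vec ?n \<Longrightarrow> x \<noteq> 0\<^sub>v ?n \<Longrightarrow> 0 < scalar_prod x (A *\<^sub>v x)"
    using assms(1) by (auto simp: sym_pos_def_def)
  obtain v where v: "v \<in> carrier_vec ?n" "scalar_prod v v > 0"
    "scalar_prod v (A *\<^sub>v v) = lambda_min A * scalar_prod v v"
    using spectrumE[OF A(1) symmetric_spectrum(1)[OF A assms(2)]] by blast
  then have "v \<noteq> 0\<^sub>v ?n" by auto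
  then show ?thesis using pos[OF v(1)] v(2,3) by (simp add: zero_less_mult_iff)
qed

text \<open>Both comparisons are evaluated at eigenvectors of \<open>A\<close>: the upper one at
  \<open>v\<close> for the largest eigenvalue, the lower one at \<open>w\<close> for the smallest.
  The matrix \<open>G\<close> enters through its Rayleigh bounds, which hold at every
  vector.\<close>

lemma cond2_spectrally_equivalent:
  fixes A G :: "real mat"
  assumes A: "sym_pos_def A" "A \<in> carrier_mat n n" and G: "sym_pos_def G" "G \<in> carrier_mat n n"
    and n: "n > 0" and \<alpha>: "0 < \<alpha>"
    and lo: "\<And>x. x \<in> carrier_vec n \<Longrightarrow> \<alpha> * scalar_prod x (G *\<^sub>v x) \<le> scalar_prod x (A *\<^sub>v x)"
    and up: "\<And>x. x \<in> carrier_vec n \<Longrightarrow> scalar_prod x (A *\<^sub>v x) \<le> c * scalar_prod x (G *\<^sub>v x)"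
    and c: "0 < c"
  shows "cond2 A \<le> c / \<alpha> * cond2 G"
proof -
  have T: "transpose_mat A = A" "transpose_mat G = G"
    using A G by (auto simp: sym_pos_def_def)
  have pos: "0 < lambda_min A" "0 < lambda_min G"
    using sym_pos_def_lambda_min_pos A G n by auto
  note SA = symmetric_spectrum[OF A(2) T(1) n] and SG = symmetric_spectrum[OF G(2) T(2) n]
  obtain v where v: "v \<in> carrier_vec n" "scalar_prod v v > 0"
    "scalar_prod v (A *\<^sub>v v) = lambda_max A * scalar_prod v v"
    using spectrumE[OF A(2) SA(2)] by blast
  have "lambda_max A * scalar_prod v v \<le> c * (lambda_max G * scalar_prod v v)"
    using up[OF v(1)] mult_left_mono[OF SG(4)[OF v(1)], of c] c v(3) by linarith
  then have mx: "lambda_max A \<le> c * lambda_max G"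
    using v(2) by (simp flip: mult.assoc)
  obtain w where w: "w \<in> carrier_vec n" "scalar_prod w w > 0"
    "scalar_prod w (A *\<^sub>v w) = lambda_min A * scalar_prod w w"
    using spectrumE[OF A(2) SA(1)] by blast
  have "\<alpha> * (lambda_min G * scalar_prod w w) \<le> lambda_min A * scalar_prod w w"
    using lo[OF w(1)] mult_left_mono[OF SG(3)[OF w(1)], of \<alpha>] \<alpha> w(3) by linarith
  then have mn: "\<alpha> * lambda_min G \<le> lambda_min A"
    using w(2) by (simp flip: mult.assoc)
  \<comment> \<open>With \<open>lambda_min A\<close> positive, this makes the numerators
    nonnegative, as comparing the two fractions requires.\<close>
  have "lambda_min A \<le> lambda_max A"
    using SA(3,4)[OF v(1)] v(2) by (meson dual_order.trans mult_le_cancel_right_pos)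
  then have "lambda_max A / lambda_min A \<le> (c * lambda_max G) / (\<alpha> * lambda_min G)"
    using pos mx mn \<alpha> by (intro frac_le) auto
  then show ?thesis by (simp add: cond2_def)
qed

section \<open>Uniqueness of weak gradients and definiteness of the inner product\<close>

lemma Ck_Suc_D: "Ck (Suc k) f \<Longrightarrow> Ck k f"
proof (induction k arbitrary: f)
  case 0
  then obtain g where "\<forall>p. GDERIV f p :> g p" by auto
  then show ?case
    unfolding gderiv_def by (auto intro!: continuous_at_imp_continuous_on has_derivative_continuous)
next
  case (Suc k)
  then obtain g where g: "\<forall>p. GDERIV f p :> g p" "Ck (Suc k) (\<lambda>p. fst (g p))" "Ck (Suc k) (\<lambda>p. snd (g p))"
    unfolding Ck.simps(2)[of "Suc k"] by blast
  show ?case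
    unfolding Ck.simps(2)[of k] using g(1) Suc.IH[OF g(2)] Suc.IH[OF g(3)] by blast
qed

lemma Ck_const: "Ck k (\<lambda>_. c)"
  by (cases k) (auto intro!: exI[of _ "\<lambda>_. 0"] GDERIV_const Ck_zero continuous_intros)

lemma Ck_fst: "Ck k fst"
proof (cases k)
  case (Suc k')
  have "GDERIV fst p :> (1, 0)" for p :: "real \<times> real"
    unfolding gderiv_def by (auto intro!: derivative_eq_intros simp: inner_prod_def)
  then show ?thesis using Suc by (auto intro!: exI[of _ "\<lambda>_. (1, 0)"] Ck_const)
qed (auto intro: continuous_intros)

lemma Ck_mult: "Ck k f \<Longrightarrow> Ck k g \<Longrightarrow> Ck k (\<lambda>p. f p * g p)"
proof (induction k arbitrary: f g)
  case (Suc k)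
  obtain f' g' where *: "\<forall>p. GDERIV f p :> f' p" "Ck k (\<lambda>p. fst (f' p))" "Ck k (\<lambda>p. snd (f' p))"
    "\<forall>p. GDERIV g p :> g' p" "Ck k (\<lambda>p. fst (g' p))" "Ck k (\<lambda>p. snd (g' p))"
    using Suc.prems by auto
  \<comment> \<open>The product rule leaves undifferentiated factors in the gradient, and the
    definition of \<open>Ck (Suc k)\<close> does not state their regularity of order
    \<open>k\<close>; it follows because differentiability implies continuity.\<close>
  have k: "Ck k f" "Ck k g" using Suc.prems by (auto intro: Ck_Suc_D simp del: Ck.simps)
  show ?case
    unfolding Ck.simps(2)
  proof (intro exI conjI allI)
    show "GDERIV (\<lambda>p. f p * g p) p :> f p *\<^sub>R g' p + g p *\<^sub>R f' p" for p
      by (intro GDERIV_mult *(1)[rule_format] *(4)[rule_format])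
    show "Ck k (\<lambda>p. fst (f p *\<^sub>R g' p + g p *\<^sub>R f' p))" "Ck k (\<lambda>p. snd (f p *\<^sub>R g' p + g p *\<^sub>R f' p))"
      using * k by (auto intro!: Ck_add Suc.IH)
  qed
qed (auto intro: continuous_intros)

lemma Ck_classical_grad:
  assumes "Ck (Suc k) f"
  shows "Ck k (\<lambda>p. fst (classical_grad f p))" "Ck k (\<lambda>p. snd (classical_grad f p))"
proof -
  obtain g where g: "\<forall>p. GDERIV f p :> g p" "Ck k (\<lambda>p. fst (g p))" "Ck k (\<lambda>p. snd (g p))"
    using assms by auto
  then have "classical_grad f = g" using classical_grad_eqI by blast
  then show "Ck k (\<lambda>p. fst (classical_grad f p))" "Ck k (\<lambda>p. snd (classical_grad f p))"
    using g by simp_all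
qed

lemma test_funD: "f \<in> test_fun \<Longrightarrow> Ck k f"
  unfolding test_fun_def by blast

lemma test_fun_supportI:
  assumes "\<And>k. Ck k g" "f \<in> test_fun" "\<And>p. p \<notin> closure {p. f p \<noteq> 0} \<Longrightarrow> g p = 0"
  shows "g \<in> test_fun"
proof -
  let ?K = "closure {p. f p \<noteq> 0}"
  have K: "compact ?K" "?K \<subseteq> Omega" using assms(2) by (simp_all add: test_fun_def)
  have "closure {p. g p \<noteq> 0} \<subseteq> ?K" using assms(3) by (intro closure_minimal) auto
  moreover from this have "compact (closure {p. g p \<noteq> 0})"
    using K(1) by (meson bounded_subset closed_closure compact_eq_bounded_closed)
  ultimately show ?thesis using assms(1) K(2) by (auto simp: test_fun_def)
qed

lemma test_fun_grad_components:
  assumes "\<phi> \<in> test_fun"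
  shows "(\<lambda>p. fst (classical_grad \<phi> p)) \<in> test_fun" "(\<lambda>p. snd (classical_grad \<phi> p)) \<in> test_fun"
  by (rule test_fun_supportI[OF _ assms]; use assms in \<open>simp add: Ck_classical_grad test_funD test_fun_grad_zero del: Ck.simps\<close>)+

lemma test_fun_mult:
  assumes "\<And>k. Ck k g" "\<phi> \<in> test_fun"
  shows "(\<lambda>p. g p * \<phi> p) \<in> test_fun"
proof (rule test_fun_supportI[OF _ assms(2)])
  show "Ck k (\<lambda>p. g p * \<phi> p)" for k
    by (intro Ck_mult assms test_funD)
  show "g p * \<phi> p = 0" if "p \<notin> closure {p. \<phi> p \<noteq> 0}" for p
    using that closure_subset[of "{p. \<phi> p \<noteq> 0}"] by auto
qed

lemma classical_grad_fst_mult: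
  assumes "\<phi> \<in> test_fun"
  shows "classical_grad (\<lambda>p. fst p * \<phi> p) p = fst p *\<^sub>R classical_grad \<phi> p + \<phi> p *\<^sub>R (1, 0)"
proof -
  have "GDERIV fst p :> (1::real, 0::real)"
    unfolding gderiv_def by (auto intro!: derivative_eq_intros simp: inner_prod_def)
  then show ?thesis
    by (intro classical_grad_eqI GDERIV_mult test_fun_GDERIV assms)
qed

section \<open>Weak gradients of null functions and functions with null gradient\<close>

abbreviation "\<mu> \<equiv> lebesgue_on Omega"

lemma L2_inner_integrable:
  fixes f g :: "real \<times> real \<Rightarrow> 'b::euclidean_space"
  assumes "f \<in> L2" "g \<in> L2"
  shows "integrable \<mu> (\<lambda>p. inner (f p) (g p))"
proof -
  have m: "f \<in> borel_measurable \<mu>" "g \<in> borel_measurable \<mu>"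
    using assms by (auto simp: L2_measurable)
  have i: "integrable \<mu> (\<lambda>p. (norm (f p))\<^sup>2 + (norm (g p))\<^sup>2)"
    by (intro Bochner_Integration.integrable_add L2_integrable assms)
  have b: "norm (inner (f p) (g p)) \<le> norm ((norm (f p))\<^sup>2 + (norm (g p))\<^sup>2)" for p
  proof -
    have "\<bar>inner (f p) (g p)\<bar> \<le> norm (f p) * norm (g p)" by (rule Cauchy_Schwarz_ineq2)
    moreover have "2 * (norm (f p) * norm (g p)) \<le> (norm (f p))\<^sup>2 + (norm (g p))\<^sup>2"
      using zero_le_power2[of "norm (f p) - norm (g p)"] by (simp add: power2_diff)
    moreover have "0 \<le> norm (f p) * norm (g p)" by simp
    ultimately have "\<bar>inner (f p) (g p)\<bar> \<le> (norm (f p))\<^sup>2 + (norm (g p))\<^sup>2" by linarith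
    then show ?thesis by simp
  qed
  show ?thesis
    by (rule Bochner_Integration.integrable_bound[OF i]) (use m b in \<open>auto intro!: AE_I2\<close>)
qed

text \<open>The assumption is an inequality because the epsilon arguments below deliver it in that
  form.\<close>

lemma L2_AE_zeroI:
  fixes f :: "real \<times> real \<Rightarrow> 'b::euclidean_space"
  assumes "f \<in> L2" "(LINT p|\<mu>. (norm (f p))\<^sup>2) \<le> 0"
  shows "AE p in \<mu>. f p = 0"
proof -
  have "(LINT p|\<mu>. (norm (f p))\<^sup>2) = 0"
    using assms(2) by (intro antisym) auto
  then have "AE p in \<mu>. (norm (f p))\<^sup>2 = 0"
    using integral_nonneg_eq_0_iff_AE[OF L2_integrable[OF assms(1)]] by auto
  then show ?thesis by simp
qed

lemma weak_grad_of_null: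
  assumes "has_weak_grad u w" "AE p in \<mu>. u p = 0" "\<phi> \<in> test_fun"
  shows "(LINT p|\<mu>. \<phi> p *\<^sub>R w p) = 0"
proof -
  have "(LINT p|\<mu>. u p *\<^sub>R classical_grad \<phi> p) = 0"
    by (rule integral_eq_zero_AE) (use assms(2) in \<open>auto elim: eventually_mono\<close>)
  then show ?thesis using has_weak_gradD(3)[OF assms(1,3)] by simp
qed

lemma weak_grad_of_null_orthogonal:
  assumes w: "has_weak_grad u w" and 0: "AE p in \<mu>. u p = 0" and \<phi>: "\<phi> \<in> test_fun"
  shows "(LINT p|\<mu>. inner (w p) (classical_grad \<phi> p)) = 0"
proof -
  let ?d1 = "\<lambda>p. fst (classical_grad \<phi> p)" and ?d2 = "\<lambda>p. snd (classical_grad \<phi> p)"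
  have wL: "w \<in> L2" by (rule has_weak_gradD[OF w])
  note T = test_fun_grad_components[OF \<phi>]
  have i: "integrable \<mu> (\<lambda>p. ?d1 p *\<^sub>R w p)" "integrable \<mu> (\<lambda>p. ?d2 p *\<^sub>R w p)"
    using T wL by (auto intro!: L2_scaleR_integrable test_fun_L2)
  \<comment> \<open>Written this way, the integral reduces to entries of the vector integrals of
    \<open>w\<close> against the two partial derivatives; these are test functions, so both
    integrals vanish.\<close>
  have eq: "inner (w p) (classical_grad \<phi> p) = inner (?d1 p *\<^sub>R w p) (1, 0) + inner (?d2 p *\<^sub>R w p) (0, 1)" for p
    by (simp add: inner_prod_def)
  have "(LINT p|\<mu>. inner (w p) (classical_grad \<phi> p))
      = (LINT p|\<mu>. inner (?d1 p *\<^sub>R w p) (1, 0)) + (LINT p|\<mu>. inner (?d2 p *\<^sub>R w p) (0, 1))"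
    unfolding eq by (intro Bochner_Integration.integral_add integrable_inner_left i)
  also have "\<dots> = inner (LINT p|\<mu>. ?d1 p *\<^sub>R w p) (1, 0) + inner (LINT p|\<mu>. ?d2 p *\<^sub>R w p) (0, 1)"
    using i by (simp only: integral_inner_left)
  also have "\<dots> = 0"
    by (simp only: weak_grad_of_null[OF w 0] T inner_zero_left)
  finally show ?thesis .
qed

text \<open>By Pythagoras, \<open>w\<close> is no longer in the L2 norm than its difference from the
  gradient of any test function, and that difference can be made arbitrarily small.\<close>

lemma h01_grad_of_null:
  assumes w: "h01_grad u w" and 0: "AE p in \<mu>. u p = 0"
  shows "AE p in \<mu>. w p = 0"
proof (rule L2_AE_zeroI)
  show wL: "w \<in> L2" by (rule has_weak_gradD[OF h01_gradD[OF w]])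
  show "(LINT p|\<mu>. (norm (w p))\<^sup>2) \<le> 0"
  proof (rule field_le_epsilon)
    fix e :: real assume "0 < e"
    then obtain \<phi> where \<phi>: "\<phi> \<in> test_fun" "(LINT p|\<mu>. (u p - \<phi> p)\<^sup>2)
        + (LINT p|\<mu>. (norm (w p - classical_grad \<phi> p))\<^sup>2) < e"
      using w unfolding h01_grad_def by blast
    let ?d = "classical_grad \<phi>"
    note T = test_fun_L2[OF \<phi>(1)]
    have eq: "(norm (w p - ?d p))\<^sup>2 = (norm (w p))\<^sup>2 + (norm (?d p))\<^sup>2 - 2 * inner (w p) (?d p)" for p
      by (simp add: power2_norm_eq_inner inner_diff inner_commute)
    have "(LINT p|\<mu>. (norm (w p - ?d p))\<^sup>2)
        = (LINT p|\<mu>. (norm (w p))\<^sup>2) + (LINT p|\<mu>. (norm (?d p))\<^sup>2) - 2 * (LINT p|\<mu>. inner (w p) (?d p))"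
      unfolding eq using L2_integrable[OF wL] L2_integrable[OF T(2)] L2_inner_integrable[OF wL T(2)] by simp
    also have "(LINT p|\<mu>. inner (w p) (?d p)) = 0"
      by (rule weak_grad_of_null_orthogonal[OF h01_gradD[OF w] 0 \<phi>(1)])
    finally have "(LINT p|\<mu>. (norm (w p))\<^sup>2) \<le> (LINT p|\<mu>. (norm (w p - ?d p))\<^sup>2)" by simp
    moreover have "0 \<le> (LINT p|\<mu>. (u p - \<phi> p)\<^sup>2)" by simp
    ultimately show "(LINT p|\<mu>. (norm (w p))\<^sup>2) \<le> 0 + e" using \<phi>(2) by linarith
  qed
qed

text \<open>The two functions need only agree almost everywhere, so the result also compares
  gradients of different representatives of one class. The difference is written with the factor -1
  to fit the closure lemmas for sums and multiples.\<close>

lemma h01_grad_unique: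
  assumes "h01_grad u g" "h01_grad v k" "AE p in \<mu>. u p = v p"
  shows "AE p in \<mu>. g p = k p"
proof -
  have "h01_grad (\<lambda>p. u p + (-1) * v p) (\<lambda>p. g p + (-1) *\<^sub>R k p)"
    by (intro h01_grad_add h01_grad_scale assms)
  then have "AE p in \<mu>. g p + (-1) *\<^sub>R k p = 0"
    by (rule h01_grad_of_null) (use assms(3) in \<open>auto elim: eventually_mono\<close>)
  then show ?thesis by (auto elim: eventually_mono)
qed

text \<open>A qualitative form of the Poincare inequality, with the coordinate \<open>fst\<close> as
  multiplier.\<close>

lemma h01_null_grad:
  assumes g: "h01_grad u g" and 0: "AE p in \<mu>. g p = 0"
  shows "AE p in \<mu>. u p = 0"
proof (rule L2_AE_zeroI)
  show uL: "u \<in> L2" by (rule has_weak_gradD[OF h01_gradD[OF g]])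
  have gL: "g \<in> L2" by (rule has_weak_gradD[OF h01_gradD[OF g]])
  have iu: "integrable \<mu> (\<lambda>p. (u p)\<^sup>2)" using L2_integrable[OF uL] by simp
  have "(LINT p|\<mu>. (u p)\<^sup>2) \<le> 0"
  proof (rule field_le_epsilon)
    fix e :: real assume "0 < e"
    \<comment> \<open>Absorbing half of the integral of \<open>(u p)\<^sup>2\<close> below doubles
      the approximation error, hence the halving.\<close>
    then have "0 < e / 2" by simp
    then obtain \<phi> where \<phi>: "\<phi> \<in> test_fun" "(LINT p|\<mu>. (u p - \<phi> p)\<^sup>2)
        + (LINT p|\<mu>. (norm (g p - classical_grad \<phi> p))\<^sup>2) < e / 2"
      using g unfolding h01_grad_def by blast
    let ?d = "classical_grad \<phi>"
    define \<eta> where "\<eta> = (\<lambda>p. fst p * \<phi> p)"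
    have \<eta>: "\<eta> \<in> test_fun" unfolding \<eta>_def by (rule test_fun_mult[OF Ck_fst \<phi>(1)])
    note T = test_fun_L2[OF \<phi>(1)] and H = test_fun_L2[OF \<eta>]
    have i1: "integrable \<mu> (\<lambda>p. u p *\<^sub>R classical_grad \<eta> p)"
      by (rule L2_scaleR_integrable[OF uL H(2)])
    have i2: "integrable \<mu> (\<lambda>p. (u p - \<phi> p)\<^sup>2)" using L2_integrable[OF L2_diff[OF uL T(1)]] by simp
    have i3: "integrable \<mu> (\<lambda>p. (norm (g p - ?d p))\<^sup>2)" by (rule L2_integrable[OF L2_diff[OF gL T(2)]])
    have "(LINT p|\<mu>. u p *\<^sub>R classical_grad \<eta> p) = - (LINT p|\<mu>. \<eta> p *\<^sub>R g p)"
      by (rule has_weak_gradD(3)[OF h01_gradD[OF g] \<eta>])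
    also have "(LINT p|\<mu>. \<eta> p *\<^sub>R g p) = 0"
      by (rule integral_eq_zero_AE) (use 0 in \<open>auto elim: eventually_mono\<close>)
    finally have z: "(LINT p|\<mu>. inner (u p *\<^sub>R classical_grad \<eta> p) (1, 0)) = 0"
      using i1 by (simp only: integral_inner_left) simp
    \<comment> \<open>The first term of the majorant integrates to 0 by \<open>z\<close>, the second
      is absorbed on the left, and the last two are the approximation error.\<close>
    have "(LINT p|\<mu>. (u p)\<^sup>2) \<le> (LINT p|\<mu>. inner (u p *\<^sub>R classical_grad \<eta> p) (1, 0)
        + ((u p)\<^sup>2 / 2 + ((u p - \<phi> p)\<^sup>2 + (norm (g p - ?d p))\<^sup>2)))"
    proof (rule integral_mono_AE[OF iu])
      show "integrable \<mu> (\<lambda>p. inner (u p *\<^sub>R classical_grad \<eta> p) (1, 0)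
        + ((u p)\<^sup>2 / 2 + ((u p - \<phi> p)\<^sup>2 + (norm (g p - ?d p))\<^sup>2)))"
        by (intro Bochner_Integration.integrable_add integrable_inner_left i1 i2 i3 integrable_divide iu)
      have pt: "(u p)\<^sup>2 \<le> inner (u p *\<^sub>R classical_grad \<eta> p) (1, 0)
        + ((u p)\<^sup>2 / 2 + ((u p - \<phi> p)\<^sup>2 + (norm (g p - ?d p))\<^sup>2))" if p: "p \<in> Omega" and g0: "g p = 0" for p
      proof -
        define a x f d where "a = u p" and "x = fst p" and "f = \<phi> p" and "d = fst (?d p)"
        \<comment> \<open>The coordinate is bounded by the width of the square, so
          \<open>x * d\<close> is controlled by the gradient of \<phi>, which is itself the error
          since \<open>g p = 0\<close>.\<close>
        have x: "x\<^sup>2 \<le> 1" using p by (auto simp: Omega_def x_def power_le_one)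
        have in1: "inner (u p *\<^sub>R classical_grad \<eta> p) (1, 0) = a * (x * d + f)"
          unfolding \<eta>_def classical_grad_fst_mult[OF \<phi>(1)]
          by (simp add: inner_prod_def a_def x_def f_def d_def)
        have "d\<^sup>2 \<le> (norm (?d p))\<^sup>2"
          by (cases "?d p") (simp add: d_def norm_Pair)
        then have dn: "x\<^sup>2 * d\<^sup>2 \<le> (norm (g p - ?d p))\<^sup>2"
          using mult_right_mono[OF x, of "d\<^sup>2"] by (simp add: g0)
        \<comment> \<open>These are the Young inequalities for the products
          \<open>- a * (x * d)\<close> and \<open>a * (a - f)\<close>, whose sum is
          \<open>a\<^sup>2 - a * (x * d + f)\<close>; each costs a quarter of
          \<open>a\<^sup>2\<close>.\<close>
        have "0 \<le> (a / 2 + x * d)\<^sup>2" "0 \<le> (a / 2 - (a - f))\<^sup>2" by simp_all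
        then have "a\<^sup>2 \<le> a * (x * d + f) + (a\<^sup>2 / 2 + ((a - f)\<^sup>2 + x\<^sup>2 * d\<^sup>2))"
          by (simp add: power2_eq_square algebra_simps)
        then show ?thesis unfolding in1 using dn by (simp add: a_def f_def)
      qed
      show "AE p in \<mu>. (u p)\<^sup>2 \<le> inner (u p *\<^sub>R classical_grad \<eta> p) (1, 0)
        + ((u p)\<^sup>2 / 2 + ((u p - \<phi> p)\<^sup>2 + (norm (g p - ?d p))\<^sup>2))"
        using 0 AE_space by eventually_elim (rule pt, auto)
    qed
    also have "\<dots> = (LINT p|\<mu>. inner (u p *\<^sub>R classical_grad \<eta> p) (1, 0))
        + ((LINT p|\<mu>. (u p)\<^sup>2) / 2 + ((LINT p|\<mu>. (u p - \<phi> p)\<^sup>2) + (LINT p|\<mu>. (norm (g p - ?d p))\<^sup>2)))"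
      using i1 i2 i3 iu
      by (simp only: Bochner_Integration.integral_add integral_divide integrable_inner_left
          Bochner_Integration.integrable_add integrable_divide) simp
    finally show "(LINT p|\<mu>. (u p)\<^sup>2) \<le> 0 + e" using z \<phi>(2) by linarith
  qed
  then show "(LINT p|\<mu>. (norm (u p))\<^sup>2) \<le> 0" by simp
qed

section \<open>Gradients of equivalence classes\<close>

lemma H01_fun_rep: "H01_fun (rep_h01 u)"
  using Quotient_rep_reflp[OF Quotient_h01] by blast

lemma h01_grad_grad: "h01_grad (rep_h01 u) (grad u)"
  using H01_fun_rep[of u] unfolding H01_fun_def grad_def by (rule someI_ex)

lemma grad_L2: "grad u \<in> L2"
  by (rule has_weak_gradD[OF h01_gradD[OF h01_grad_grad]])

lemma rep_abs_h01_AE: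
  assumes "H01_fun f"
  shows "AE p in \<mu>. rep_h01 (abs_h01 f) p = f p"
  using Quotient_rep_abs[OF Quotient_h01, of f] assms by auto

text \<open>The representative of a sum agrees only almost everywhere with the sum of the
  representatives; uniqueness of the weak gradient bridges this and the arbitrary choice in
  \<open>grad\<close>.\<close>

lemma grad_add: "AE p in \<mu>. grad (u + v) p = grad u p + grad v p"
proof (rule h01_grad_unique[OF h01_grad_grad h01_grad_add[OF h01_grad_grad h01_grad_grad]])
  show "AE p in \<mu>. rep_h01 (u + v) p = rep_h01 u p + rep_h01 v p"
    unfolding plus_h01_def map_fun_def o_def id_def
    by (intro rep_abs_h01_AE H01_fun_add H01_fun_rep)
qed

lemma grad_scaleR: "AE p in \<mu>. grad (c *\<^sub>R u) p = c *\<^sub>R grad u p"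
proof (rule h01_grad_unique[OF h01_grad_grad h01_grad_scale[OF h01_grad_grad]])
  show "AE p in \<mu>. rep_h01 (c *\<^sub>R u) p = c * rep_h01 u p"
    unfolding scaleR_h01_def map_fun_def o_def id_def
    by (intro rep_abs_h01_AE H01_fun_scale H01_fun_rep)
qed

lemma h01_eq_zeroI:
  assumes "AE p in \<mu>. grad u p = 0"
  shows "u = 0"
proof -
  have "AE p in \<mu>. rep_h01 u p = 0"
    by (rule h01_null_grad[OF h01_grad_grad assms])
  then have "abs_h01 (rep_h01 u) = abs_h01 (\<lambda>_. 0)"
    using Quotient_rel[OF Quotient_h01, of "rep_h01 u" "\<lambda>_. 0"] H01_fun_rep H01_fun_zero by blast
  then show ?thesis
    using Quotient_abs_rep[OF Quotient_h01, of u] by (simp add: zero_h01_def)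
qed

section \<open>The energy form and the inner product\<close>

lemma energy_integrable:
  assumes "coefficient \<kappa>min \<kappa>max \<kappa>"
  shows "integrable \<mu> (\<lambda>p. \<kappa> p * inner (grad u p) (grad v p))"
proof (rule Bochner_Integration.integrable_bound)
  show "integrable \<mu> (\<lambda>p. \<kappa>max * inner (grad u p) (grad v p))"
    by (intro integrable_mult_right L2_inner_integrable grad_L2)
  show "(\<lambda>p. \<kappa> p * inner (grad u p) (grad v p)) \<in> borel_measurable \<mu>"
    using assms L2_measurable[OF grad_L2[of u]] L2_measurable[OF grad_L2[of v]]
    by (auto simp: coefficient_def)
  have "\<bar>\<kappa> p\<bar> \<le> \<bar>\<kappa>max\<bar>" if "p \<in> Omega" for p
    using assms that by (force simp: coefficient_def)
  then show "AE p in \<mu>. norm (\<kappa> p * inner (grad u p) (grad v p))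
      \<le> norm (\<kappa>max * inner (grad u p) (grad v p))"
    by (intro AE_I2) (auto simp: abs_mult intro: mult_right_mono)
qed

lemma energy_form_commute: "energy_form \<kappa> u v = energy_form \<kappa> v u"
  by (simp add: energy_form_def inner_commute)

lemma energy_form_linear_left:
  assumes \<kappa>: "coefficient \<kappa>min \<kappa>max \<kappa>"
  shows "linear (\<lambda>u. energy_form \<kappa> u v)"
proof (rule linearI)
  note i = energy_integrable[OF \<kappa>]
  note m = i[THEN borel_measurable_integrable]
  show "energy_form \<kappa> (u + w) v = energy_form \<kappa> u v + energy_form \<kappa> w v" for u w
  proof -
    have "energy_form \<kappa> (u + w) v = (LINT p|\<mu>. \<kappa> p * inner (grad u p) (grad v p) + \<kappa> p * inner (grad w p) (grad v p))"
      unfolding energy_form_def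
    proof (rule integral_cong_AE)
      show "AE p in \<mu>. \<kappa> p * inner (grad (u + w) p) (grad v p)
          = \<kappa> p * inner (grad u p) (grad v p) + \<kappa> p * inner (grad w p) (grad v p)"
        using grad_add[of u w] by eventually_elim (simp add: inner_add_left distrib_left)
    qed (use m in \<open>auto intro: borel_measurable_add\<close>)
    then show ?thesis using i by (simp add: energy_form_def)
  qed
  show "energy_form \<kappa> (c *\<^sub>R u) v = c *\<^sub>R energy_form \<kappa> u v" for c u
  proof -
    have "energy_form \<kappa> (c *\<^sub>R u) v = (LINT p|\<mu>. c * (\<kappa> p * inner (grad u p) (grad v p)))"
      unfolding energy_form_def
    proof (rule integral_cong_AE)
      show "AE p in \<mu>. \<kappa> p * inner (grad (c *\<^sub>R u) p) (grad v p)
          = c * (\<kappa> p * inner (grad u p) (grad v p))"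
        using grad_scaleR[of c u] by eventually_elim simp
    qed (use m in \<open>auto intro: borel_measurable_times\<close>)
    then show ?thesis by (simp add: energy_form_def)
  qed
qed

text \<open>Viewing the inner product as the energy form of the constant coefficient 1 lets
  linearity and symmetry be proved once for both matrices.\<close>

lemma h01_inner_eq_energy_form: "h01_inner = energy_form (\<lambda>_. 1)"
  by (intro ext) (simp add: h01_inner_def energy_form_def)

lemma coefficient_one: "coefficient 1 1 (\<lambda>_. 1)"
  by (simp add: coefficient_def)

lemma h01_norm_power2: "(h01_norm u)\<^sup>2 = h01_inner u u"
  unfolding h01_norm_def h01_inner_def by (simp add: real_sqrt_pow2)

lemma h01_inner_pos:
  assumes "u \<noteq> 0"
  shows "0 < h01_inner u u"
proof (rule ccontr)
  assume "\<not> 0 < h01_inner u u"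
  then have "(LINT p|\<mu>. (norm (grad u p))\<^sup>2) \<le> 0"
    by (simp add: h01_inner_def power2_norm_eq_inner)
  then show False
    using L2_AE_zeroI[OF grad_L2] h01_eq_zeroI assms by blast
qed

section \<open>Matrices of a bilinear form in a basis\<close>

lemma inj_independent_sum_zero:
  fixes \<psi> :: "nat \<Rightarrow> 'v::real_vector" and x :: "nat \<Rightarrow> real"
  assumes "inj_on \<psi> {..<K}" "independent (\<psi> ` {..<K})"
    and "(\<Sum>i<K. x i *\<^sub>R \<psi> i) = 0" "i < K"
  shows "x i = 0"
proof -
  \<comment> \<open>Independence concerns sets of vectors; injectivity lets the coefficients of the
    family be read as a function on that set.\<close>
  let ?y = "\<lambda>v. x (inv_into {..<K} \<psi> v)"
  have "(\<Sum>v\<in>\<psi> ` {..<K}. ?y v *\<^sub>R v) = 0"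
    using assms(1,3) by (subst sum.reindex) auto
  then have "?y (\<psi> i) = 0"
    using assms(2,4) independentD[of "\<psi> ` {..<K}" "\<psi> ` {..<K}" ?y "\<psi> i"] by auto
  then show ?thesis using assms(1,4) by simp
qed

lemma form_matrix_carrier: "form_matrix K b \<psi> \<in> carrier_mat K K"
  by (simp add: form_matrix_def)

text \<open>Entry \<open>(i, j)\<close> has the column index in the first argument, so linearity
  there turns row \<open>i\<close> applied to \<open>x\<close> into \<open>b v (\<psi> i)\<close>.
  Symmetry then allows the same linearity to sum over the rows.\<close>

lemma form_matrix_quadratic:
  fixes b :: "'v::real_vector \<Rightarrow> 'v \<Rightarrow> real" and \<psi> :: "nat \<Rightarrow> 'v"
  assumes lin: "\<And>v. linear (\<lambda>u. b u v)" and sym: "\<And>u v. b u v = b v u"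
    and x: "x \<in> carrier_vec K"
  defines "v \<equiv> (\<Sum>i<K. vec_index x i *\<^sub>R \<psi> i)"
  shows "scalar_prod x (form_matrix K b \<psi> *\<^sub>v x) = b v v"
proof -
  have l: "b v w = (\<Sum>j<K. vec_index x j * b (\<psi> j) w)" for w
    unfolding v_def by (simp add: linear_sum[OF lin] linear_cmul[OF lin])
  have "vec_index (form_matrix K b \<psi> *\<^sub>v x) i = b v (\<psi> i)" if "i < K" for i
    using that x unfolding l
    by (auto simp: form_matrix_def scalar_prod_def atLeast0LessThan mult.commute intro!: sum.cong)
  then have "scalar_prod x (form_matrix K b \<psi> *\<^sub>v x) = (\<Sum>i<K. vec_index x i * b (\<psi> i) v)"
    using x by (auto simp: scalar_prod_def form_matrix_def atLeast0LessThan sym[of v] intro!: sum.cong)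
  then show ?thesis using l[of v] by simp
qed

lemma form_matrix_sym_pos_def:
  fixes b :: "'v::real_vector \<Rightarrow> 'v \<Rightarrow> real" and \<psi> :: "nat \<Rightarrow> 'v"
  assumes lin: "\<And>v. linear (\<lambda>u. b u v)" and sym: "\<And>u v. b u v = b v u"
    and pos: "\<And>u. u \<noteq> 0 \<Longrightarrow> 0 < b u u"
    and basis: "basis_family K \<psi> W"
  shows "sym_pos_def (form_matrix K b \<psi>)"
  unfolding sym_pos_def_def
proof (intro conjI ballI impI)
  show "square_mat (form_matrix K b \<psi>)" by (simp add: form_matrix_def)
  show "transpose_mat (form_matrix K b \<psi>) = form_matrix K b \<psi>"
    by (intro eq_matI) (auto simp: form_matrix_def sym)
  fix x :: "real vec"
  assume "x \<in> carrier_vec (dim_row (form_matrix K b \<psi>))" "x \<noteq> 0\<^sub>v (dim_row (form_matrix K b \<psi>))"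
  then have x: "x \<in> carrier_vec K" "x \<noteq> 0\<^sub>v K" by (simp_all add: form_matrix_def)
  then obtain i where "i < K" "vec_index x i \<noteq> 0"
    by (metis carrier_vecD eq_vecI index_zero_vec)
  then have "(\<Sum>i<K. vec_index x i *\<^sub>R \<psi> i) \<noteq> 0"
    using basis inj_independent_sum_zero unfolding basis_family_def by blast
  then show "0 < scalar_prod x (form_matrix K b \<psi> *\<^sub>v x)"
    using pos by (simp add: form_matrix_quadratic[OF lin sym x(1)])
qed

text \<open>The order of the quantifiers expresses the uniformity: the bound is chosen from
  \<open>c\<close>, \<alpha> and \<open>C\<^sub>G\<close> alone, before the coefficient, the
  admissible pairs \<open>(h, M)\<close>, the spaces, the projections and the bases.\<close>

theorem theorem4p5:
  fixes c \<alpha> C\<^sub>G :: real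
  assumes "0 < c" and "0 < \<alpha>"
  shows "\<exists>C\<^sub>c\<^sub>o\<^sub>n\<^sub>d>0. \<forall>(\<kappa> :: real \<times> real \<Rightarrow> real) \<kappa>min \<kappa>max (Idx :: (real \<times> nat) set)
      (V :: real \<Rightarrow> h01 set) (D :: real \<Rightarrow> h01 set) (Proj :: real \<Rightarrow> h01 \<Rightarrow> h01)
      (\<psi> :: real \<Rightarrow> nat \<Rightarrow> nat \<Rightarrow> h01).
    coefficient \<kappa>min \<kappa>max \<kappa> \<longrightarrow>
    continuous_form c (energy_form \<kappa>) \<longrightarrow>
    coercive_form \<alpha> (energy_form \<kappa>) \<longrightarrow>
    (\<forall>(h, M)\<in>Idx. 0 < h \<and> 1 \<le> M \<and>
       fin_dim_subspace (V h) \<and>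
       projection_onto (Proj h) (D h) (V h) \<and> spectral_space M \<subseteq> D h \<and>
       dim (Proj h ` spectral_space M) = M\<^sup>2 \<and>
       basis_family (M\<^sup>2) (\<psi> h M) (Proj h ` spectral_space M)) \<longrightarrow>
    (\<forall>(h, M)\<in>Idx. cond2 (form_matrix (M\<^sup>2) h01_inner (\<psi> h M)) \<le> C\<^sub>G) \<longrightarrow>
    (\<forall>(h, M)\<in>Idx. sym_pos_def (form_matrix (M\<^sup>2) (energy_form \<kappa>) (\<psi> h M)) \<and>
       cond2 (form_matrix (M\<^sup>2) (energy_form \<kappa>) (\<psi> h M)) \<le> C\<^sub>c\<^sub>o\<^sub>n\<^sub>d)"
\<comment> \<open>The factor \<open>c / \<alpha>\<close> is the price of the spectral comparison.
  The absolute value covers a \<open>C\<^sub>G\<close> of any sign, and the summand 1 makes the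
  constant strictly positive.\<close>
proof (intro exI[of _ "c / \<alpha> * \<bar>C\<^sub>G\<bar> + 1"] conjI allI impI)
  show "0 < c / \<alpha> * \<bar>C\<^sub>G\<bar> + 1" using assms by (intro add_nonneg_pos) auto
next
  fix \<kappa> :: "real \<times> real \<Rightarrow> real" and \<kappa>min \<kappa>max and Idx :: "(real \<times> nat) set"
    and V D :: "real \<Rightarrow> h01 set" and Proj :: "real \<Rightarrow> h01 \<Rightarrow> h01" and \<psi> :: "real \<Rightarrow> nat \<Rightarrow> nat \<Rightarrow> h01"
  assume \<kappa>: "coefficient \<kappa>min \<kappa>max \<kappa>"
    and cont: "continuous_form c (energy_form \<kappa>)" and coer: "coercive_form \<alpha> (energy_form \<kappa>)"
    and idx: "\<forall>(h, M)\<in>Idx. 0 < h \<and> 1 \<le> M \<and>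
       fin_dim_subspace (V h) \<and>
       projection_onto (Proj h) (D h) (V h) \<and> spectral_space M \<subseteq> D h \<and>
       dim (Proj h ` spectral_space M) = M\<^sup>2 \<and>
       basis_family (M\<^sup>2) (\<psi> h M) (Proj h ` spectral_space M)"
    and gram: "\<forall>(h, M)\<in>Idx. cond2 (form_matrix (M\<^sup>2) h01_inner (\<psi> h M)) \<le> C\<^sub>G"
  have up: "energy_form \<kappa> u u \<le> c * h01_inner u u" for u
    using cont[unfolded continuous_form_def, rule_format, of u u]
    by (simp add: power2_eq_square mult.assoc flip: h01_norm_power2)
  have lo: "\<alpha> * h01_inner u u \<le> energy_form \<kappa> u u" for u
    using coer unfolding coercive_form_def by (simp add: h01_norm_power2)
  have pos: "0 < energy_form \<kappa> u u" if "u \<noteq> 0" for u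
    using lo[of u] mult_pos_pos[OF assms(2) h01_inner_pos[OF that]] by linarith
  note lin = energy_form_linear_left[OF \<kappa>]
    and lin1 = energy_form_linear_left[OF coefficient_one, folded h01_inner_eq_energy_form]
  note com1 = energy_form_commute[of "\<lambda>_. 1", folded h01_inner_eq_energy_form]
  show "\<forall>(h, M)\<in>Idx. sym_pos_def (form_matrix (M\<^sup>2) (energy_form \<kappa>) (\<psi> h M)) \<and>
       cond2 (form_matrix (M\<^sup>2) (energy_form \<kappa>) (\<psi> h M)) \<le> c / \<alpha> * \<bar>C\<^sub>G\<bar> + 1"
  proof (clarify, intro conjI)
    fix h M assume hM: "(h, M) \<in> Idx"
    let ?A = "form_matrix (M\<^sup>2) (energy_form \<kappa>) (\<psi> h M)"
    let ?G = "form_matrix (M\<^sup>2) h01_inner (\<psi> h M)"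
    \<comment> \<open>Here \<open>1 \<le> M\<close> gives matrices of positive dimension, for which
      the extreme eigenvalues exist.\<close>
    have M: "0 < M\<^sup>2" and basis: "basis_family (M\<^sup>2) (\<psi> h M) (Proj h ` spectral_space M)"
      using idx hM by auto
    show A: "sym_pos_def ?A"
      by (rule form_matrix_sym_pos_def[OF lin energy_form_commute pos basis])
    have G: "sym_pos_def ?G"
      by (rule form_matrix_sym_pos_def[OF lin1 com1 h01_inner_pos basis])
    have "cond2 ?A \<le> c / \<alpha> * cond2 ?G"
      by (rule cond2_spectrally_equivalent[OF A form_matrix_carrier G form_matrix_carrier M assms(2) _ _ assms(1)])
         (simp_all add: form_matrix_quadratic[OF lin energy_form_commute]
            form_matrix_quadratic[OF lin1 com1] lo up)
    also have "\<dots> \<le> c / \<alpha> * \<bar>C\<^sub>G\<bar>"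
      using gram hM assms by (intro mult_left_mono) auto
    finally show "cond2 ?A \<le> c / \<alpha> * \<bar>C\<^sub>G\<bar> + 1" by simp
  qed
qed

end
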